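(* Let $p$ be a prime, let $G$ be a finite $p$-group with $|G|\ge p^2$, and let $I$ be the intersection of all subgroups of $G$ of order $p^2$. Then $|\pi_0\Gamma_{p,1}(G)|=|I|$. In particular, $\Gamma_{p,1}(G)$ is disconnected if and only if $I\ne 1$.
   Context: $\operatorname{Irr}(H)$ is the set of complex irreducible characters of $H$. $\Gamma_{p,1}(G)$ is the set of all pairs $(H,\varphi)$ with $H$ a $p$-subgroup of $G$ of order greater than $p$ and $\varphi\in\operatorname{Irr}(H)$, partially ordered by: $(H,\varphi)\le(K,\psi)$ if $H\le K$ and $[\varphi,\psi_H]\ne 0$, where $\psi_H$ is the restriction of $\psi$ to $H$ and $[\cdot,\cdot]$ is the inner product of characters. In a poset $X$, two elements lie in the same connected component if they can be joined by a finite sequence of elements of $X$ in which every two consecutive elements are comparable; $\pi_0X$ is the set of connected components. $X$ is connected if it has exactly one connected component, and disconnected otherwise. *)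

theory Defs
  imports
    "HOL-Algebra.Coset"
    "HOL-Computational_Algebra.Primes"
    "Jordan_Normal_Form.VS_Connect"
begin

definition mat_trace :: "'a::comm_monoid_add mat \<Rightarrow> 'a" where
  "mat_trace A = (\<Sum>i<dim_row A. A $$ (i, i))"

definition matrix_rep :: "('a, 'b) monoid_scheme \<Rightarrow> nat \<Rightarrow> ('a \<Rightarrow> complex mat) \<Rightarrow> bool" where
  "matrix_rep H n \<rho> \<longleftrightarrow> \<rho> \<in> hom H (units_of (ring_mat TYPE(complex) n ()))"

definition invariant_subspace ::
  "('a, 'b) monoid_scheme \<Rightarrow> nat \<Rightarrow> ('a \<Rightarrow> complex mat) \<Rightarrow> complex vec set \<Rightarrow> bool" where
  "invariant_subspace H n \<rho> W \<longleftrightarrow>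
     VectorSpace.subspace class_ring W (module_vec TYPE(complex) n) \<and>
     (\<forall>h\<in>carrier H. \<forall>w\<in>W. \<rho> h *\<^sub>v w \<in> W)"

definition irreducible_rep :: "('a, 'b) monoid_scheme \<Rightarrow> nat \<Rightarrow> ('a \<Rightarrow> complex mat) \<Rightarrow> bool" where
  "irreducible_rep H n \<rho> \<longleftrightarrow>
     matrix_rep H n \<rho> \<and> n > 0 \<and>
     (\<forall>W. invariant_subspace H n \<rho> W \<longrightarrow> W = {0\<^sub>v n} \<or> W = carrier_vec n)"

text \<open>
  Characters are represented by functions that are \<^const>\<open>undefined\<close> outside the group, so that
  distinct elements of \<open>Irr H\<close> differ on \<open>H\<close>.
\<close>

definition character :: "('a, 'b) monoid_scheme \<Rightarrow> ('a \<Rightarrow> complex mat) \<Rightarrow> 'a \<Rightarrow> complex" where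
  "character H \<rho> = restrict (\<lambda>h. mat_trace (\<rho> h)) (carrier H)"

definition Irr :: "('a, 'b) monoid_scheme \<Rightarrow> ('a \<Rightarrow> complex) set" where
  "Irr H = {\<chi>. \<exists>n \<rho>. irreducible_rep H n \<rho> \<and> \<chi> = character H \<rho>}"

definition char_inner :: "'a set \<Rightarrow> ('a \<Rightarrow> complex) \<Rightarrow> ('a \<Rightarrow> complex) \<Rightarrow> complex" where
  "char_inner H \<phi> \<psi> = (\<Sum>h\<in>H. \<phi> h * cnj (\<psi> h)) / of_nat (card H)"

definition Gamma1 :: "nat \<Rightarrow> ('a, 'b) monoid_scheme \<Rightarrow> ('a set \<times> ('a \<Rightarrow> complex)) set" where
  "Gamma1 p G =
     {(H, \<phi>). subgroup H G \<and> (\<exists>k. card H = p ^ k) \<and> card H > p \<and> \<phi> \<in> Irr (G\<lparr>carrier := H\<rparr>)}"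

definition Gamma1_le :: "nat \<Rightarrow> ('a, 'b) monoid_scheme \<Rightarrow> ('a set \<times> ('a \<Rightarrow> complex)) rel" where
  "Gamma1_le p G =
     {((H, \<phi>), (K, \<psi>)). (H, \<phi>) \<in> Gamma1 p G \<and> (K, \<psi>) \<in> Gamma1 p G \<and>
        H \<subseteq> K \<and> char_inner H \<phi> (restrict \<psi> H) \<noteq> 0}"

definition poset_components :: "'c set \<Rightarrow> 'c rel \<Rightarrow> 'c set set" where
  "poset_components X r = X // ((r \<union> r\<inverse>) \<inter> X \<times> X)\<^sup>*"

definition poset_connected :: "'c set \<Rightarrow> 'c rel \<Rightarrow> bool" where
  "poset_connected X r \<longleftrightarrow> (\<exists>!C. C \<in> poset_components X r)"

text \<open>
  The family below is nonempty (so the intersection lies in \<open>carrier G\<close>) when \<open>G\<close> is a finite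
  \<open>p\<close>-group of order at least \<open>p ^ 2\<close>.
\<close>

definition inter_order_p2 :: "nat \<Rightarrow> ('a, 'b) monoid_scheme \<Rightarrow> 'a set" where
  "inter_order_p2 p G = \<Inter>{H. subgroup H G \<and> card H = p ^ 2}"

end

(*
  The subgroup I is central, so an irreducible character phi of a subgroup H containing I satisfies
  phi(zh) = lambda(z) phi(h) for z in I, with a linear character lambda of I. The substitution
  h -> zh in the inner product shows that lambda is constant on components, and a finite abelian
  group I has |I| linear characters. It remains to join any two pairs with the same lambda.

  Every pair lies above some (A, mu) with |A| = p^2, and then A is abelian and mu is linear.
  If linear characters mu of A and nu of B agree on the intersection of A and B, then some
  irreducible character of G lies above both: the product of the two corresponding idempotents of
  the group algebra has a nonzero coefficient at 1, hence a nonzero trace on the regular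
  representation. So two characters of A that agree on the intersection of A and B lie in the same
  component. The same fact inside A yields joint extensions, by which this property passes to
  intersections of such subgroups of A, and therefore holds for I.
*)

theory Submission
  imports Defs "Jordan_Normal_Form.Schur_Decomposition"
    "Jordan_Normal_Form.Spectral_Radius" "HOL-Algebra.Multiplicative_Group"
    "HOL-Algebra.Group_Action" "HOL-Algebra.Sylow"
begin

section \<open>Bases adapted to a subspace\<close>

text \<open>Centrality of I: every element lies in an abelian subgroup of order greater than p, and
  any such subgroup contains one of order p^2, hence I. The same inclusion gives every pair of the
  poset its lambda. Irreducible characters are found by traces. A linear expression in the trace
  values that is nonzero for a representation is nonzero for an invariant subspace or for its
  quotient, so descent in the dimension reaches an irreducible representation. On the regular
  representation such an expression is the coefficient at the identity times the group order.
  Different choices of coefficients give characters that separate the elements of an abelian group,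
  from which the count of linear characters follows, and characters of G above two linear ones. The
  obstacle in the joining step is that agreement on I is in general weaker than agreement on one
  intersection of A and B. If two characters of A agree on the intersection of A and B, a character
  of B that extends their common restriction links them; handling the finitely many B one at a time
  brings the agreement down to I.\<close>

lemma (in vectorspace) extend_to_basis_of_subspace:
  assumes "fin_dim" and W: "VectorSpace.subspace K W V" and B: "B \<subseteq> W" "lin_indpt B"
  obtains C where "B \<subseteq> C" "C \<subseteq> W" "lin_indpt C" "finite C" "span C = W"
proof -
  have WV: "W \<subseteq> carrier V"
    using W by (auto simp: VectorSpace.subspace_def submodule_def)
  let ?P = "\<lambda>S. B \<subseteq> S \<and> S \<subseteq> W \<and> lin_indpt S"
  \<comment> \<open>Independent sets have at most \<open>dim\<close> elements, so a maximal one
    between \<open>B\<close> and \<open>W\<close> exists; a vector of \<open>W\<close> outside its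
    span would enlarge it.\<close>
  obtain C where C: "finite C" "maximal C ?P"
    using maximal_exists[of ?P dim B] li_le_dim[OF assms(1)] B WV by (metis subset_trans order_refl)
  then have C': "B \<subseteq> C" "C \<subseteq> W" "lin_indpt C"
    by (auto simp: maximal_def)
  have "w \<in> span C" if "w \<in> W" for w
  proof (rule ccontr)
    assume "w \<notin> span C"
    then have "w \<notin> C"
      using in_own_span C'(2) WV by blast
    with \<open>w \<notin> span C\<close> have "lin_indpt (C \<union> {w})"
      using lin_dep_iff_in_span[of C w] C' WV that by auto
    then show False
      using C(2) C'(1,2) that \<open>w \<notin> C\<close> unfolding maximal_def by (metis Un_insert_right insertI1 insert_subset sup_bot_right sup.cobounded1 subset_trans)
  qed
  moreover have "span C \<subseteq> W"
    using W C' by (intro span_is_subset) (auto simp: VectorSpace.subspace_def)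
  ultimately show thesis
    using C' C(1) that by blast
qed

lemma (in vec_space) subspace_carrier_vec: "VectorSpace.subspace class_ring (carrier_vec n) V"
proof -
  have "LinearCombinations.submodule class_ring (carrier_vec n) V"
    by (rule LinearCombinations.submodule.intro) (use module_axioms in auto)
  then show ?thesis using vec_vs by (simp add: VectorSpace.subspace_def)
qed

text \<open>Conjugation by \<open>P\<close> turns every matrix that preserves \<open>W\<close> into
  a block upper triangular one. The columns of \<open>P\<close> are a basis of \<open>W\<close>
  followed by vectors that complete it to a basis of the whole space.\<close>

lemma (in vec_space) adapted_basis:
  assumes W: "VectorSpace.subspace class_ring W V"
  obtains P Q k where "P \<in> carrier_mat n n" "Q \<in> carrier_mat n n" "P * Q = 1\<^sub>m n" "Q * P = 1\<^sub>m n"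
    "k \<le> n" "W = {P *\<^sub>v v | v. v \<in> carrier_vec n \<and> (\<forall>i\<in>{k..<n}. v $ i = 0)}"
proof -
  have WV: "W \<subseteq> carrier_vec n"
    using W by (auto simp: VectorSpace.subspace_def submodule_def)
  have "lin_indpt {}"
    by (simp add: lin_dep_def)
  then obtain B where B: "B \<subseteq> W" "lin_indpt B" "finite B" "span B = W"
    using extend_to_basis_of_subspace[OF fin_dim W] by (metis empty_subsetI)
  obtain C where C: "B \<subseteq> C" "C \<subseteq> carrier_vec n" "lin_indpt C" "finite C" "span C = carrier_vec n"
    by (rule extend_to_basis_of_subspace[OF fin_dim subspace_carrier_vec, of B]) (use B(1,2) WV in auto)
  have "basis C"
    using C by (simp add: basis_def)
  then have card_C: "card C = n"
    using dim_basis C(4) dim_is_n by simp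
  obtain bs where bs: "set bs = B" "distinct bs"
    using finite_distinct_list[OF B(3)] by blast
  obtain cs where cs: "set cs = C - B" "distinct cs"
    using finite_distinct_list C(4) by (metis finite_Diff)
  define ws where "ws = bs @ cs"
  define P where "P = mat_of_cols n ws"
  define k where "k = length bs"
  have ws: "set ws = C" "distinct ws"
    using bs cs C(1) by (auto simp: ws_def)
  have len: "length ws = n"
    using ws card_C distinct_card by metis
  have P: "P \<in> carrier_mat n n"
    using len by (auto simp: P_def)
  have "cols P = ws"
    using C(2) ws by (simp add: P_def)
  then have "{y \<in> carrier_vec n. \<exists>x\<in>carrier_vec n. P *\<^sub>v x = y} = carrier_vec n"
    using col_space_eq[OF P] C(5) ws P by (simp add: col_space_def)
  then have surj: "\<exists>x\<in>carrier_vec n. P *\<^sub>v x = y" if "y \<in> carrier_vec n" for y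
    using that by blast
  then have "\<forall>j. \<exists>x. j < n \<longrightarrow> x \<in> carrier_vec n \<and> P *\<^sub>v x = unit_vec n j"
    by (metis unit_vec_carrier)
  then obtain q where q: "\<And>j. j < n \<Longrightarrow> q j \<in> carrier_vec n" "\<And>j. j < n \<Longrightarrow> P *\<^sub>v q j = unit_vec n j"
    by metis
  \<comment> \<open>The columns of \<open>Q\<close> are preimages of the unit vectors under
    \<open>P\<close>, which makes \<open>Q\<close> a right inverse; for square matrices it is then
    two-sided.\<close>
  define Q where "Q = mat_of_cols n (map q [0..<n])"
  have Q: "Q \<in> carrier_mat n n"
    by (auto simp: Q_def)
  have PQ: "P * Q = 1\<^sub>m n"
  proof (rule mat_col_eqI)
    fix j assume "j < dim_col (1\<^sub>m n)"
    then have j: "j < n" by simp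
    have "col Q j = q j"
      using j q(1) by (simp add: Q_def)
    then have "col (P * Q) j = unit_vec n j"
      using col_mult2[OF P Q j] q(2)[OF j] by metis
    then show "col (P * Q) j = col (1\<^sub>m n) j"
      using j by simp
  qed (use P Q in auto)
  have QP: "Q * P = 1\<^sub>m n"
    by (rule mat_mult_left_right_inverse[OF P Q PQ])
  have k: "k \<le> n"
    using len by (simp add: k_def ws_def)
  define P1 where "P1 = mat_of_cols n bs"
  have P1: "P1 \<in> carrier_mat n k"
    by (auto simp: P1_def k_def)
  have "cols P1 = bs"
    using B WV bs by (simp add: P1_def)
  then have W_eq: "W = {y \<in> carrier_vec n. \<exists>x\<in>carrier_vec k. P1 *\<^sub>v x = y}"
    using col_space_eq[OF P1] B(4) bs P1 by (simp add: col_space_def)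
  have P_P1: "P *\<^sub>v v = P1 *\<^sub>v vec k (($) v)"
    if v: "v \<in> carrier_vec n" and 0: "\<And>i. i \<in> {k..<n} \<Longrightarrow> v $ i = 0" for v
  proof (rule eq_vecI)
    fix i assume "i < dim_vec (P1 *\<^sub>v vec k (($) v))"
    then have i: "i < n" using P1 by simp
    have "(P *\<^sub>v v) $ i = (\<Sum>j\<in>{0..<n}. P $$ (i, j) * v $ j)"
      using i P v by (simp add: scalar_prod_def)
    also have "\<dots> = (\<Sum>j\<in>{0..<k}. P $$ (i, j) * v $ j)"
      using k 0 by (intro sum.mono_neutral_right) auto
    also have "\<dots> = (\<Sum>j\<in>{0..<k}. P1 $$ (i, j) * v $ j)"
      using i len k by (intro sum.cong) (auto simp: P_def P1_def mat_of_cols_index ws_def nth_append k_def)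
    also have "\<dots> = (P1 *\<^sub>v vec k (($) v)) $ i"
      using i P1 by (simp add: scalar_prod_def)
    finally show "(P *\<^sub>v v) $ i = (P1 *\<^sub>v vec k (($) v)) $ i" .
  qed (use P P1 in auto)
  have "W = {P *\<^sub>v v | v. v \<in> carrier_vec n \<and> (\<forall>i\<in>{k..<n}. v $ i = 0)}" (is "_ = ?R")
  proof (intro equalityI subsetI)
    fix w assume "w \<in> W"
    then obtain x where x: "x \<in> carrier_vec k" "w = P1 *\<^sub>v x"
      using W_eq by auto
    let ?v = "vec n (\<lambda>i. if i < k then x $ i else 0)"
    have "vec k (($) ?v) = x"
      using x k by auto
    then have "P *\<^sub>v ?v = w"
      using P_P1[of ?v] x by simp
    then show "w \<in> ?R"
      by (intro CollectI exI[of _ ?v]) auto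
  next
    fix w assume "w \<in> ?R"
    then show "w \<in> W"
      using P_P1 W_eq P by auto
  qed
  then show thesis
    using that P Q PQ QP k by blast
qed

section \<open>Traces and matrix representations\<close>

lemma mat_trace_mult_comm:
  fixes A B :: "'a::comm_semiring_0 mat"
  assumes "A \<in> carrier_mat n m" "B \<in> carrier_mat m n"
  shows "mat_trace (A * B) = mat_trace (B * A)"
proof -
  have "mat_trace (A * B) = (\<Sum>i<n. \<Sum>j<m. A $$ (i, j) * B $$ (j, i))"
    using assms by (auto simp: mat_trace_def scalar_prod_def atLeast0LessThan intro!: sum.cong)
  also have "\<dots> = (\<Sum>j<m. \<Sum>i<n. B $$ (j, i) * A $$ (i, j))"
    by (subst sum.swap) (simp add: mult.commute)
  also have "\<dots> = mat_trace (B * A)"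
    using assms by (auto simp: mat_trace_def scalar_prod_def atLeast0LessThan intro!: sum.cong)
  finally show ?thesis .
qed

lemma mat_trace_conj:
  fixes A :: "'a::comm_ring_1 mat"
  assumes "A \<in> carrier_mat n n" "P \<in> carrier_mat n n" "Q \<in> carrier_mat n n" "P * Q = 1\<^sub>m n"
  shows "mat_trace (Q * A * P) = mat_trace A"
proof -
  have "mat_trace (Q * A * P) = mat_trace (P * (Q * A))"
    using assms by (intro mat_trace_mult_comm[of _ n n]) auto
  also have "P * (Q * A) = A"
    using assms by (simp flip: assoc_mult_mat[of _ n n _ n _ n])
  finally show ?thesis .
qed

text \<open>The diagonal of an upper triangular idempotent consists of zeros and ones.\<close>

lemma idempotent_trace_0:
  fixes E :: "complex mat"
  assumes E: "E \<in> carrier_mat n n" "E * E = E" and tr: "mat_trace E = 0"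
  shows "E = 0\<^sub>m n n"
proof -
  obtain es where "char_poly E = (\<Prod>e\<leftarrow>es. [:- e, 1:])"
    using char_poly_factorized[OF E(1)] by blast
  then obtain B where B: "B \<in> carrier_mat n n" "upper_triangular B" "similar_mat E B"
    using schur_decomposition_exists[OF E(1)] by blast
  then obtain P Q where "similar_mat_wit E B P Q"
    by (auto simp: similar_mat_def)
  note wit = similar_mat_witD2[OF E(1) this]
  have cancel: "Q * (P * X) = X" "P * (Q * X) = X" if "X \<in> carrier_mat n n" for X
    using that wit(1,2,6,7) by (simp_all flip: assoc_mult_mat[of _ n n _ n _ n])
  have PEQ: "Q * E * P = B"
    using wit(2,5-7) unfolding wit(3) by (simp add: assoc_mult_mat[of _ n n _ n _ n] cancel)
  have "B * B = Q * (E * E) * P"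
    using E(1) wit(6,7) unfolding PEQ[symmetric] by (simp add: assoc_mult_mat[of _ n n _ n _ n] cancel)
  then have BB: "B * B = B"
    using E PEQ by simp
  have tri: "B $$ (i, j) = 0" if "j < i" "i < n" for i j
    using B that by (auto simp: upper_triangular_def)
  have entry: "(\<Sum>l<n. B $$ (i, l) * B $$ (l, j)) = B $$ (i, j)" if "i < n" "j < n" for i j
  proof -
    have "(B * B) $$ (i, j) = (\<Sum>l<n. B $$ (i, l) * B $$ (l, j))"
      using that B by (simp add: scalar_prod_def atLeast0LessThan)
    then show ?thesis
      using BB by simp
  qed
  have diag: "B $$ (i, i) = 0 \<or> B $$ (i, i) = 1" if "i < n" for i
  proof -
    have "(\<Sum>l<n. B $$ (i, l) * B $$ (l, i)) = (\<Sum>l\<in>{i}. B $$ (i, l) * B $$ (l, i))"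
      using that tri by (intro sum.mono_neutral_right) (auto, meson linorder_neqE_nat)
    then have "B $$ (i, i) * B $$ (i, i) = B $$ (i, i)"
      using entry[OF that that] by simp
    then show ?thesis
      by simp
  qed
  have "mat_trace B = 0"
    using mat_trace_conj[OF E(1) wit(6,7,1)] tr PEQ by simp
  then have "(\<Sum>i<n. B $$ (i, i)) = 0"
    using B by (simp add: mat_trace_def)
  then have "(\<Sum>i<n. Re (B $$ (i, i))) = 0"
    by (metis Re_sum zero_complex.sel(1))
  then have "\<forall>i\<in>{..<n}. Re (B $$ (i, i)) = 0"
    using diag by (subst (asm) sum_nonneg_eq_0_iff) (auto, metis order_refl one_complex.sel(1) zero_complex.sel(1) zero_le_one)
  then have diag0: "B $$ (i, i) = 0" if "i < n" for i
    using diag[OF that] that by (metis lessThan_iff one_complex.sel(1) zero_neq_one)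
  \<comment> \<open>Induction on the distance from the diagonal: in the entry equation of
    \<open>B * B = B\<close>, a product with \<open>i < l < j\<close> contains an entry closer to
    the diagonal, and every other product contains an entry on or below the diagonal.\<close>
  have zero: "B $$ (i, j) = 0" if "i < n" "j < n" for i j
    using that
  proof (induction "j - i" arbitrary: i j rule: less_induct)
    case less
    have "B $$ (i, l) * B $$ (l, j) = 0" if l: "l < n" for l
    proof (cases "i < l \<and> l < j")
      case True
      then show ?thesis
        using less.hyps[of l i] less.prems l by auto
    next
      case False
      then have "l < i \<or> l = i \<or> l = j \<or> j < l"
        by linarith
      then show ?thesis
        using tri diag0 l less.prems by auto
    qed
    then have "(\<Sum>l<n. B $$ (i, l) * B $$ (l, j)) = 0"
      by (intro sum.neutral) blast
    then show ?case
      using entry[OF less.prems] by simp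
  qed
  have "B = 0\<^sub>m n n"
    using B zero by auto
  then show ?thesis
    using wit by simp
qed

text \<open>Invertibility of \<open>\<rho> g\<close> is automatic, because the image of the inverse
  of \<open>g\<close> inverts it.\<close>

lemma matrix_rep_iff:
  assumes "group H"
  shows "matrix_rep H n \<rho> \<longleftrightarrow> (\<forall>g\<in>carrier H. \<rho> g \<in> carrier_mat n n) \<and> \<rho> \<one>\<^bsub>H\<^esub> = 1\<^sub>m n \<and>
    (\<forall>g\<in>carrier H. \<forall>h\<in>carrier H. \<rho> (g \<otimes>\<^bsub>H\<^esub> h) = \<rho> g * \<rho> h)" (is "?L \<longleftrightarrow> ?R")
proof
  interpret H: group H by fact
  let ?M = "ring_mat TYPE(complex) n ()"
  have "Group.monoid ?M"
    using ring_mat[where ?'a = complex, of n "()"] by (simp add: ring_def)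
  then have units: "group (units_of ?M)"
    by (rule monoid.units_group)
  {
    assume ?L
    then have hom: "\<rho> \<in> hom H (units_of ?M)"
      by (simp add: matrix_rep_def)
    then have "\<rho> \<one>\<^bsub>H\<^esub> = 1\<^sub>m n"
      using group_hom.hom_one[of H "units_of ?M" \<rho>] units H.group_axioms
      by (simp add: group_hom_def group_hom_axioms_def units_of_one ring_mat_simps)
    moreover have "\<rho> g \<in> carrier_mat n n" if "g \<in> carrier H" for g
      using hom_in_carrier[OF hom that] by (auto simp: units_of_carrier Units_def ring_mat_simps)
    ultimately show ?R
      using hom by (auto simp: hom_def units_of_mult ring_mat_simps)
  next
    assume R: ?R
    have "\<rho> g \<in> Units ?M" if g: "g \<in> carrier H" for g
    proof -
      have carr: "\<rho> g \<in> carrier_mat n n" "\<rho> (inv\<^bsub>H\<^esub> g) \<in> carrier_mat n n"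
        using R g H.inv_closed by blast+
      have "\<rho> g * \<rho> (inv\<^bsub>H\<^esub> g) = \<rho> (g \<otimes>\<^bsub>H\<^esub> inv\<^bsub>H\<^esub> g)"
        using R g H.inv_closed by metis
      moreover have "\<rho> (inv\<^bsub>H\<^esub> g) * \<rho> g = \<rho> (inv\<^bsub>H\<^esub> g \<otimes>\<^bsub>H\<^esub> g)"
        using R g H.inv_closed by metis
      ultimately have "\<rho> g * \<rho> (inv\<^bsub>H\<^esub> g) = 1\<^sub>m n" "\<rho> (inv\<^bsub>H\<^esub> g) * \<rho> g = 1\<^sub>m n"
        using R g by simp_all
      then show ?thesis
        using carr unfolding Units_def ring_mat_simps by blast
    qed
    then show ?L
      using R by (auto simp: matrix_rep_def hom_def units_of_carrier units_of_mult ring_mat_simps)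
  }
qed

lemma mat_mult_entry:
  assumes "A \<in> carrier_mat n m" "B \<in> carrier_mat m l" "i < n" "j < l"
  shows "(A * B) $$ (i, j) = (\<Sum>k<m. A $$ (i, k) * B $$ (k, j))"
  using assms by (simp add: scalar_prod_def atLeast0LessThan)

lemma subspace_carrier_vecI:
  fixes W :: "complex vec set"
  assumes "W \<subseteq> carrier_vec n" "0\<^sub>v n \<in> W" "\<And>v w. v \<in> W \<Longrightarrow> w \<in> W \<Longrightarrow> v + w \<in> W"
    and "\<And>c v. v \<in> W \<Longrightarrow> c \<cdot>\<^sub>v v \<in> W"
  shows "VectorSpace.subspace class_ring W (module_vec TYPE(complex) n)"
  unfolding VectorSpace.subspace_def
  by (intro conjI vec_vs LinearCombinations.submodule.intro vec_module)
    (use assms in \<open>auto simp: module_vec_simps\<close>)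

text \<open>
  The traces only see the two diagonal blocks, so no invariant complement of \<open>W\<close> is needed.
\<close>

lemma split_rep:
  assumes H: "group H" and rep: "matrix_rep H n \<rho>" and inv: "invariant_subspace H n \<rho> W"
    and W: "W \<noteq> {0\<^sub>v n}" "W \<noteq> carrier_vec n"
  obtains k \<alpha> \<gamma> where "0 < k" "k < n" "matrix_rep H k \<alpha>" "matrix_rep H (n - k) \<gamma>"
    "\<And>g. g \<in> carrier H \<Longrightarrow> mat_trace (\<rho> g) = mat_trace (\<alpha> g) + mat_trace (\<gamma> g)"
proof -
  interpret H: group H by fact
  interpret vec_space "TYPE(complex)" n .
  note rho = rep[unfolded matrix_rep_iff[OF H]]
  have "VectorSpace.subspace class_ring W V"
    using inv by (simp add: invariant_subspace_def)
  then obtain P Q k where P: "P \<in> carrier_mat n n" and Q: "Q \<in> carrier_mat n n"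
    and PQ: "P * Q = 1\<^sub>m n" and QP: "Q * P = 1\<^sub>m n" and kn: "k \<le> n"
    and W_eq: "W = {P *\<^sub>v v | v. v \<in> carrier_vec n \<and> (\<forall>i\<in>{k..<n}. v $ i = 0)}"
    by (rule adapted_basis)
  have "k \<noteq> 0"
  proof
    assume "k = 0"
    then have "W = {P *\<^sub>v v | v. v \<in> carrier_vec n \<and> v = 0\<^sub>v n}"
      unfolding W_eq by (intro Collect_cong ex_cong1) auto
    then show False
      using W(1) P by auto
  qed
  moreover have "k \<noteq> n"
  proof
    assume "k = n"
    have "w \<in> W" if "w \<in> carrier_vec n" for w
    proof -
      have "P *\<^sub>v (Q *\<^sub>v w) = w"
        using assoc_mult_mat_vec[OF P Q that] PQ that by simp
      then show ?thesis
        using that Q \<open>k = n\<close> unfolding W_eq by (intro CollectI exI[of _ "Q *\<^sub>v w"]) auto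
    qed
    then show False
      using W(2) P unfolding W_eq by auto
  qed
  ultimately have k: "0 < k" "k < n"
    using kn by auto
  define M where "M g = Q * \<rho> g * P" for g
  have M: "M g \<in> carrier_mat n n" if "g \<in> carrier H" for g
    using that rho P Q by (auto simp: M_def)
  have cancel: "P * (Q * X) = X" if "X \<in> carrier_mat n n" for X
    using P Q PQ that by (simp flip: assoc_mult_mat[of _ n n _ n _ n])
  have M_mult: "M (g \<otimes>\<^bsub>H\<^esub> h) = M g * M h" if "g \<in> carrier H" "h \<in> carrier H" for g h
  proof -
    have "\<rho> g \<in> carrier_mat n n" "\<rho> h \<in> carrier_mat n n" "\<rho> (g \<otimes>\<^bsub>H\<^esub> h) = \<rho> g * \<rho> h"
      using rho that by auto
    then show ?thesis
      using P Q by (simp add: M_def assoc_mult_mat[of _ n n _ n _ n] cancel)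
  qed
  have M_one: "M \<one>\<^bsub>H\<^esub> = 1\<^sub>m n"
    using rho P Q QP by (simp add: M_def)
  \<comment> \<open>The first \<open>k\<close> columns of \<open>P\<close> lie in \<open>W\<close>,
    which \<open>\<rho> g\<close> preserves; hence the lower left block of \<open>M g\<close>
    vanishes.\<close>
  have M_0: "M g $$ (i, j) = 0" if g: "g \<in> carrier H" and ij: "k \<le> i" "i < n" "j < k" for g i j
  proof -
    have "P *\<^sub>v unit_vec n j \<in> W"
      using ij k unfolding W_eq by (intro CollectI exI[of _ "unit_vec n j"]) auto
    then have "\<rho> g *\<^sub>v (P *\<^sub>v unit_vec n j) \<in> W"
      using inv g by (auto simp: invariant_subspace_def)
    then obtain v where v: "v \<in> carrier_vec n" "\<forall>i\<in>{k..<n}. v $ i = 0"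
      "\<rho> g *\<^sub>v (P *\<^sub>v unit_vec n j) = P *\<^sub>v v"
      unfolding W_eq by blast
    have \<rho>g: "\<rho> g \<in> carrier_mat n n"
      using rho g by blast
    have "M g *\<^sub>v unit_vec n j = Q *\<^sub>v (\<rho> g *\<^sub>v (P *\<^sub>v unit_vec n j))"
      using P Q \<rho>g by (simp add: M_def assoc_mult_mat_vec[of _ n n _ n])
    also have "\<dots> = Q *\<^sub>v (P *\<^sub>v v)"
      using v(3) by simp
    also have "\<dots> = v"
      using assoc_mult_mat_vec[OF Q P v(1)] QP v(1) by simp
    finally have "(M g *\<^sub>v unit_vec n j) $ i = 0"
      using v(2) ij by simp
    then show ?thesis
      using M[OF g] ij k by simp
  qed
  \<comment> \<open>In the new coordinates \<open>\<alpha>\<close> is the action on \<open>W\<close>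
    and \<open>\<gamma>\<close> the action on the quotient by \<open>W\<close>.\<close>
  define \<alpha> where "\<alpha> g = mat k k (\<lambda>(i, j). M g $$ (i, j))" for g
  define \<gamma> where "\<gamma> g = mat (n - k) (n - k) (\<lambda>(i, j). M g $$ (k + i, k + j))" for g
  have split_sum: "(\<Sum>l<n. f l) = (\<Sum>l<k. f l) + (\<Sum>l<n - k. f (k + l))" for f :: "nat \<Rightarrow> complex"
  proof -
    have "(\<Sum>l<n. f l) = (\<Sum>l\<in>{0..<k}. f l) + (\<Sum>l\<in>{k..<n}. f l)"
      using k by (simp add: sum.atLeastLessThan_concat atLeast0LessThan[symmetric])
    also have "(\<Sum>l\<in>{k..<n}. f l) = (\<Sum>l<n - k. f (k + l))"
      using sum.shift_bounds_nat_ivl[of f 0 k "n - k"] k by (simp add: add.commute atLeast0LessThan)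
    finally show ?thesis
      by (simp add: atLeast0LessThan)
  qed
  have M_mult_entry: "M (g \<otimes>\<^bsub>H\<^esub> h) $$ (i, j) =
      (\<Sum>l<k. M g $$ (i, l) * M h $$ (l, j)) + (\<Sum>l<n - k. M g $$ (i, k + l) * M h $$ (k + l, j))"
    if "g \<in> carrier H" "h \<in> carrier H" "i < n" "j < n" for g h i j
    using mat_mult_entry[OF M[OF that(1)] M[OF that(2)] that(3,4)] M_mult that split_sum by simp
  have "matrix_rep H k \<alpha>"
    unfolding matrix_rep_iff[OF H]
  proof (intro conjI ballI)
    show "\<alpha> \<one>\<^bsub>H\<^esub> = 1\<^sub>m k"
      using k by (auto simp: \<alpha>_def M_one)
    fix g h assume gh: "g \<in> carrier H" "h \<in> carrier H"
    show "\<alpha> (g \<otimes>\<^bsub>H\<^esub> h) = \<alpha> g * \<alpha> h"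
      using k gh M_0 by (intro eq_matI) (auto simp: \<alpha>_def M_mult_entry scalar_prod_def atLeast0LessThan)
  qed (simp add: \<alpha>_def)
  moreover have "matrix_rep H (n - k) \<gamma>"
    unfolding matrix_rep_iff[OF H]
  proof (intro conjI ballI)
    show "\<gamma> \<one>\<^bsub>H\<^esub> = 1\<^sub>m (n - k)"
      using k by (auto simp: \<gamma>_def M_one)
    fix g h assume gh: "g \<in> carrier H" "h \<in> carrier H"
    show "\<gamma> (g \<otimes>\<^bsub>H\<^esub> h) = \<gamma> g * \<gamma> h"
      using k gh M_0 by (intro eq_matI) (auto simp: \<gamma>_def M_mult_entry scalar_prod_def atLeast0LessThan)
  qed (simp add: \<gamma>_def)
  moreover have "mat_trace (\<rho> g) = mat_trace (\<alpha> g) + mat_trace (\<gamma> g)" if g: "g \<in> carrier H" for g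
  proof -
    have "mat_trace (\<rho> g) = mat_trace (M g)"
      using mat_trace_conj[of "\<rho> g" n P Q] rho g P Q PQ by (simp add: M_def)
    also have "\<dots> = mat_trace (\<alpha> g) + mat_trace (\<gamma> g)"
      using M[OF g] split_sum by (simp add: mat_trace_def \<alpha>_def \<gamma>_def)
    finally show ?thesis .
  qed
  ultimately show thesis
    using that k by blast
qed

text \<open>The sum is the trace of the group algebra element with coefficients \<open>f\<close>.
  For a reducible representation it splits into the same sums for two representations of smaller
  dimension, one of which must be nonzero.\<close>

lemma exists_irreducible_constituent:
  fixes f :: "'a \<Rightarrow> complex"
  assumes H: "group H" and "matrix_rep H n \<rho>" "(\<Sum>g\<in>carrier H. f g * mat_trace (\<rho> g)) \<noteq> 0"
  shows "\<exists>m \<sigma>. irreducible_rep H m \<sigma> \<and> (\<Sum>g\<in>carrier H. f g * mat_trace (\<sigma> g)) \<noteq> 0"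
  using assms(2,3)
proof (induction n arbitrary: \<rho> rule: less_induct)
  case (less n)
  note rho = less.prems(1)[unfolded matrix_rep_iff[OF H]]
  show ?case
  proof (cases "irreducible_rep H n \<rho>")
    case False
    have "n > 0"
    proof (rule ccontr)
      assume "\<not> n > 0"
      then have "mat_trace (\<rho> g) = 0" if "g \<in> carrier H" for g
        using rho that by (auto simp: mat_trace_def)
      then show False
        using less.prems(2) by simp
    qed
    then obtain W where "invariant_subspace H n \<rho> W" "W \<noteq> {0\<^sub>v n}" "W \<noteq> carrier_vec n"
      using False less.prems(1) by (auto simp: irreducible_rep_def)
    then obtain k \<alpha> \<gamma> where k: "0 < k" "k < n"
      and reps: "matrix_rep H k \<alpha>" "matrix_rep H (n - k) \<gamma>"
      and tr: "\<And>g. g \<in> carrier H \<Longrightarrow> mat_trace (\<rho> g) = mat_trace (\<alpha> g) + mat_trace (\<gamma> g)"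
      using split_rep[OF H less.prems(1)] by metis
    have "(\<Sum>g\<in>carrier H. f g * mat_trace (\<rho> g)) =
        (\<Sum>g\<in>carrier H. f g * mat_trace (\<alpha> g)) + (\<Sum>g\<in>carrier H. f g * mat_trace (\<gamma> g))"
      by (simp add: tr distrib_left sum.distrib)
    then consider "(\<Sum>g\<in>carrier H. f g * mat_trace (\<alpha> g)) \<noteq> 0" | "(\<Sum>g\<in>carrier H. f g * mat_trace (\<gamma> g)) \<noteq> 0"
      using less.prems(2) by fastforce
    then show ?thesis
    proof cases
      case 1
      show ?thesis
        by (rule less.IH[OF k(2) reps(1) 1])
    next
      case 2
      show ?thesis
        by (rule less.IH[OF _ reps(2) 2]) (use k in simp)
    qed
  qed (use less.prems in blast)
qed

text \<open>Left multiplication, written as permutation matrices in an enumeration \<open>e\<close>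
  of the group. The trace counts fixed points, and left multiplication by an element other than the
  identity has none.\<close>

lemma regular_rep:
  assumes H: "group H" and fin: "finite (carrier H)"
  obtains \<rho> where "matrix_rep H (Coset.order H) \<rho>"
    "\<And>g. g \<in> carrier H \<Longrightarrow> mat_trace (\<rho> g) = (if g = \<one>\<^bsub>H\<^esub> then of_nat (Coset.order H) else 0)"
proof -
  interpret H: group H by fact
  let ?N = "Coset.order H"
  obtain e where e: "bij_betw e {..<?N} (carrier H)"
    using ex_bij_betw_nat_finite[OF fin] unfolding Coset.order_def atLeast0LessThan by blast
  have e_in: "e i \<in> carrier H" if "i < ?N" for i
    using e that by (auto simp: bij_betw_def)
  have e_inj: "e i = e j \<longleftrightarrow> i = j" if "i < ?N" "j < ?N" for i j
    using e that by (auto simp: bij_betw_def inj_on_def)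
  have e_surj: "\<exists>i<?N. e i = g" if "g \<in> carrier H" for g
    using e that unfolding bij_betw_def by (metis imageE lessThan_iff)
  define \<rho> :: "'a \<Rightarrow> complex mat" where "\<rho> g = mat ?N ?N (\<lambda>(i, j). if e i = g \<otimes>\<^bsub>H\<^esub> e j then 1 else 0)" for g
  have "matrix_rep H ?N \<rho>"
    unfolding matrix_rep_iff[OF H]
  proof (intro conjI ballI)
    show "\<rho> \<one>\<^bsub>H\<^esub> = 1\<^sub>m ?N"
      by (rule eq_matI) (auto simp: \<rho>_def e_in e_inj)
    fix g h assume g: "g \<in> carrier H" and h: "h \<in> carrier H"
    show "\<rho> (g \<otimes>\<^bsub>H\<^esub> h) = \<rho> g * \<rho> h"
    proof (rule eq_matI)
      fix i j assume "i < dim_row (\<rho> g * \<rho> h)" "j < dim_col (\<rho> g * \<rho> h)"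
      then have ij: "i < ?N" "j < ?N"
        by (auto simp: \<rho>_def)
      obtain m where m: "m < ?N" "e m = h \<otimes>\<^bsub>H\<^esub> e j"
        using e_surj e_in[OF ij(2)] h by (metis H.m_closed)
      have "(\<rho> g * \<rho> h) $$ (i, j) =
          (\<Sum>l<?N. (if e i = g \<otimes>\<^bsub>H\<^esub> e l then 1 else 0) * (if e l = h \<otimes>\<^bsub>H\<^esub> e j then 1 else 0))"
        using ij by (subst mat_mult_entry[where n = ?N and m = ?N and l = ?N]) (auto simp: \<rho>_def)
      also have "\<dots> = (\<Sum>l<?N. if l = m then (if e i = g \<otimes>\<^bsub>H\<^esub> e m then 1 else 0) else 0)"
        using m by (intro sum.cong) (auto simp: e_inj simp flip: m(2))
      also have "\<dots> = \<rho> (g \<otimes>\<^bsub>H\<^esub> h) $$ (i, j)"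
        using m ij g h e_in[OF ij(2)] by (simp add: \<rho>_def H.m_assoc)
      finally show "\<rho> (g \<otimes>\<^bsub>H\<^esub> h) $$ (i, j) = (\<rho> g * \<rho> h) $$ (i, j)" ..
    qed (auto simp: \<rho>_def)
  qed (simp add: \<rho>_def)
  moreover have "mat_trace (\<rho> g) = (if g = \<one>\<^bsub>H\<^esub> then of_nat ?N else 0)" if g: "g \<in> carrier H" for g
  proof -
    have "mat_trace (\<rho> g) = (\<Sum>i<?N. if e i = g \<otimes>\<^bsub>H\<^esub> e i then 1 else 0)"
      by (simp add: mat_trace_def \<rho>_def)
    also have "\<dots> = (\<Sum>i<?N. if g = \<one>\<^bsub>H\<^esub> then 1 else 0)"
      using g e_in by (intro sum.cong refl) (simp add: H.l_cancel_one' eq_commute)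
    finally show ?thesis
      by simp
  qed
  ultimately show thesis
    using that by blast
qed

text \<open>On the regular representation the sum is \<open>f \<one>\<close> times the group order.
  A suitable choice of \<open>f\<close> then produces irreducible representations with prescribed
  properties.\<close>

lemma exists_irreducible_rep:
  fixes f :: "'a \<Rightarrow> complex"
  assumes H: "group H" and fin: "finite (carrier H)" and f: "f \<one>\<^bsub>H\<^esub> \<noteq> 0"
  shows "\<exists>m \<sigma>. irreducible_rep H m \<sigma> \<and> (\<Sum>g\<in>carrier H. f g * mat_trace (\<sigma> g)) \<noteq> 0"
proof -
  interpret H: group H by fact
  obtain \<rho> where \<rho>: "matrix_rep H (Coset.order H) \<rho>"
    "\<And>g. g \<in> carrier H \<Longrightarrow> mat_trace (\<rho> g) = (if g = \<one>\<^bsub>H\<^esub> then of_nat (Coset.order H) else 0)"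
    using regular_rep[OF H fin] by blast
  have "(\<Sum>g\<in>carrier H. f g * mat_trace (\<rho> g)) = (\<Sum>g\<in>carrier H. if g = \<one>\<^bsub>H\<^esub> then f g * of_nat (Coset.order H) else 0)"
    by (intro sum.cong) (auto simp: \<rho>)
  also have "\<dots> = f \<one>\<^bsub>H\<^esub> * of_nat (Coset.order H)"
    using fin by simp
  also have "\<dots> \<noteq> 0"
    using f H.order_gt_0_iff_finite fin by simp
  finally show ?thesis
    by (rule exists_irreducible_constituent[OF H \<rho>(1)])
qed

text \<open>Schur's lemma for a central element: \<open>\<rho> z\<close> commutes with the whole
  representation, so an eigenspace of it is invariant and therefore everything.\<close>

lemma central_scalar:
  assumes H: "group H" and irr: "irreducible_rep H n \<rho>" and z: "z \<in> carrier H"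
    and central: "\<And>h. h \<in> carrier H \<Longrightarrow> z \<otimes>\<^bsub>H\<^esub> h = h \<otimes>\<^bsub>H\<^esub> z"
  obtains c where "\<rho> z = c \<cdot>\<^sub>m 1\<^sub>m n"
proof -
  have n: "n > 0" and rep: "matrix_rep H n \<rho>"
    using irr by (auto simp: irreducible_rep_def)
  note rho = rep[unfolded matrix_rep_iff[OF H]]
  have \<rho>z: "\<rho> z \<in> carrier_mat n n"
    using rho z by blast
  obtain c v where v: "v \<in> carrier_vec n" "v \<noteq> 0\<^sub>v n" "\<rho> z *\<^sub>v v = c \<cdot>\<^sub>v v"
    using spectrum_non_empty[OF \<rho>z n] \<rho>z by (auto simp: spectrum_def eigenvalue_def eigenvector_def)
  define W where "W = {w \<in> carrier_vec n. \<rho> z *\<^sub>v w = c \<cdot>\<^sub>v w}"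
  have "VectorSpace.subspace class_ring W (module_vec TYPE(complex) n)"
    using \<rho>z by (intro subspace_carrier_vecI)
      (auto simp: W_def mult_add_distrib_mat_vec[of _ n n] smult_add_distrib_vec mult_mat_vec smult_smult_assoc mult.commute)
  moreover have "\<rho> h *\<^sub>v w \<in> W" if h: "h \<in> carrier H" and w: "w \<in> W" for h w
  proof -
    have \<rho>h: "\<rho> h \<in> carrier_mat n n"
      using rho h by blast
    have "\<rho> (z \<otimes>\<^bsub>H\<^esub> h) = \<rho> z * \<rho> h" "\<rho> (h \<otimes>\<^bsub>H\<^esub> z) = \<rho> h * \<rho> z"
      using rho h z by blast+
    then have "\<rho> z * \<rho> h = \<rho> h * \<rho> z"
      using central[OF h] by simp
    then have "\<rho> z *\<^sub>v (\<rho> h *\<^sub>v w) = \<rho> h *\<^sub>v (\<rho> z *\<^sub>v w)"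
      using \<rho>z \<rho>h w by (simp add: W_def flip: assoc_mult_mat_vec[of _ n n _ n])
    then show ?thesis
      using w \<rho>h by (auto simp: W_def mult_mat_vec)
  qed
  moreover have "W \<noteq> {0\<^sub>v n}"
    using v by (auto simp: W_def)
  ultimately have W: "W = carrier_vec n"
    using irr by (auto simp: irreducible_rep_def invariant_subspace_def)
  have "\<rho> z = c \<cdot>\<^sub>m 1\<^sub>m n"
  proof (rule eq_matI)
    fix i j assume ij: "i < dim_row (c \<cdot>\<^sub>m 1\<^sub>m n)" "j < dim_col (c \<cdot>\<^sub>m 1\<^sub>m n)"
    then have "unit_vec n j \<in> W"
      unfolding W by simp
    then have "(\<rho> z *\<^sub>v unit_vec n j) $ i = (c \<cdot>\<^sub>v unit_vec n j) $ i"
      by (simp add: W_def)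
    then show "\<rho> z $$ (i, j) = (c \<cdot>\<^sub>m 1\<^sub>m n) $$ (i, j)"
      using ij \<rho>z by auto
  qed (use \<rho>z in auto)
  then show thesis
    using that by blast
qed

lemma matrix_rep_subgroup:
  assumes "group G" "subgroup A G" "matrix_rep G n \<rho>"
  shows "matrix_rep (G\<lparr>carrier := A\<rparr>) n \<rho>"
proof -
  have "group (G\<lparr>carrier := A\<rparr>)"
    using assms subgroup.subgroup_is_group by blast
  then show ?thesis
    using assms(3) subgroup.subset[OF assms(2)]
    by (auto simp: matrix_rep_iff[OF assms(1)] matrix_rep_iff[of "G\<lparr>carrier := A\<rparr>"])
qed

text \<open>A central \<open>z\<close> acts as a scalar \<open>c\<close>, so translation by
  \<open>z\<close> multiplies \<open>\<phi>\<close> by \<open>c\<close>, and \<open>c\<close> is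
  \<open>\<phi> z\<close> divided by the degree \<open>\<phi> \<one>\<close>. The equation is stated
  with this denominator cleared.\<close>

lemma Irr_central:
  assumes H: "group H" and \<phi>: "\<phi> \<in> Irr H"
  shows Irr_one_neq_0: "\<phi> \<one>\<^bsub>H\<^esub> \<noteq> 0"
    and Irr_mult_central: "\<And>z h. z \<in> carrier H \<Longrightarrow> h \<in> carrier H \<Longrightarrow>
      (\<And>h. h \<in> carrier H \<Longrightarrow> z \<otimes>\<^bsub>H\<^esub> h = h \<otimes>\<^bsub>H\<^esub> z) \<Longrightarrow>
      \<phi> (z \<otimes>\<^bsub>H\<^esub> h) * \<phi> \<one>\<^bsub>H\<^esub> = \<phi> z * \<phi> h"
proof -
  interpret H: group H by fact
  obtain n \<rho> where irr: "irreducible_rep H n \<rho>" and \<phi>_eq: "\<phi> = character H \<rho>"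
    using \<phi> by (auto simp: Irr_def)
  have n: "n > 0" and rep: "matrix_rep H n \<rho>"
    using irr by (auto simp: irreducible_rep_def)
  note rho = rep[unfolded matrix_rep_iff[OF H]]
  have one: "\<phi> \<one>\<^bsub>H\<^esub> = of_nat n"
    using rho by (simp add: \<phi>_eq character_def mat_trace_def)
  then show "\<phi> \<one>\<^bsub>H\<^esub> \<noteq> 0"
    using n by simp
  fix z h assume z: "z \<in> carrier H" and h: "h \<in> carrier H"
    and central: "\<And>h. h \<in> carrier H \<Longrightarrow> z \<otimes>\<^bsub>H\<^esub> h = h \<otimes>\<^bsub>H\<^esub> z"
  obtain c where c: "\<rho> z = c \<cdot>\<^sub>m 1\<^sub>m n"
    by (rule central_scalar[OF H irr z central])
  have \<rho>h: "\<rho> h \<in> carrier_mat n n"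
    using rho h by blast
  have "\<rho> (z \<otimes>\<^bsub>H\<^esub> h) = c \<cdot>\<^sub>m \<rho> h"
    using rho z h c mult_smult_assoc_mat[OF one_carrier_mat \<rho>h, of c] left_mult_one_mat[OF \<rho>h] by simp
  then have "\<phi> (z \<otimes>\<^bsub>H\<^esub> h) = c * \<phi> h"
    using z h \<rho>h by (simp add: \<phi>_eq character_def mat_trace_def sum_distrib_left)
  moreover have "\<phi> z = c * of_nat n"
    using z by (simp add: \<phi>_eq character_def mat_trace_def c)
  ultimately show "\<phi> (z \<otimes>\<^bsub>H\<^esub> h) * \<phi> \<one>\<^bsub>H\<^esub> = \<phi> z * \<phi> h"
    by (simp add: one)
qed

section \<open>Linear characters\<close>

text \<open>For a group these are the homomorphisms into the multiplicative group of the complex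
  numbers; the value 1 at the identity excludes the zero function. Extensionality makes them
  comparable with the elements of \<open>Irr H\<close>.\<close>

definition linear_chars :: "('a, 'b) monoid_scheme \<Rightarrow> ('a \<Rightarrow> complex) set" where
  "linear_chars H = {\<mu> \<in> extensional (carrier H). \<mu> \<one>\<^bsub>H\<^esub> = 1 \<and>
     (\<forall>x\<in>carrier H. \<forall>y\<in>carrier H. \<mu> (x \<otimes>\<^bsub>H\<^esub> y) = \<mu> x * \<mu> y)}"

lemma linear_chars_subset_Irr:
  assumes H: "group H"
  shows "linear_chars H \<subseteq> Irr H"
proof
  fix \<mu> assume \<mu>: "\<mu> \<in> linear_chars H"
  define \<rho> :: "'a \<Rightarrow> complex mat" where "\<rho> g = mat 1 1 (\<lambda>_. \<mu> g)" for g
  have "matrix_rep H 1 \<rho>"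
    unfolding matrix_rep_iff[OF H]
    using \<mu> by (auto simp: \<rho>_def linear_chars_def scalar_prod_def intro!: eq_matI)
  moreover have "W = {0\<^sub>v 1} \<or> W = carrier_vec 1" if inv: "invariant_subspace H 1 \<rho> W" for W
  proof -
    have sub: "LinearCombinations.submodule class_ring W (module_vec TYPE(complex) 1)"
      using inv by (simp add: invariant_subspace_def VectorSpace.subspace_def)
    have W: "W \<subseteq> carrier_vec 1" "0\<^sub>v 1 \<in> W" "\<And>c w. w \<in> W \<Longrightarrow> c \<cdot>\<^sub>v w \<in> W"
      using sub unfolding LinearCombinations.submodule_def by (auto simp: module_vec_simps class_ring_simps)
    show ?thesis
    proof (cases "W = {0\<^sub>v 1}")
      case False
      then obtain w where w: "w \<in> W" "w \<noteq> 0\<^sub>v 1"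
        using W(2) by blast
      then have w1: "w \<in> carrier_vec 1"
        using W(1) by blast
      have "w $ 0 \<noteq> 0"
      proof
        assume "w $ 0 = 0"
        then have "w = 0\<^sub>v 1"
          using w1 by (intro eq_vecI) auto
        then show False
          using w(2) by simp
      qed
      have "v \<in> W" if "v \<in> carrier_vec 1" for v
      proof -
        have "v = (v $ 0 / w $ 0) \<cdot>\<^sub>v w"
          using that w1 \<open>w $ 0 \<noteq> 0\<close> by (intro eq_vecI) auto
        then show ?thesis
          using W(3)[OF w(1), of "v $ 0 / w $ 0"] by simp
      qed
      then show ?thesis
        using W(1) by blast
    qed simp
  qed
  ultimately have "irreducible_rep H 1 \<rho>"
    by (simp add: irreducible_rep_def)
  moreover have "\<mu> = character H \<rho>"
    using \<mu> by (auto simp: linear_chars_def character_def \<rho>_def mat_trace_def extensional_def)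
  ultimately show "\<mu> \<in> Irr H"
    by (auto simp: Irr_def)
qed

text \<open>All elements are central and act as scalars, so the line spanned by the first unit
  vector is invariant. Irreducibility makes it the whole space, and the dimension is 1.\<close>

lemma Irr_comm_group:
  assumes "comm_group H"
  shows "Irr H = linear_chars H"
proof
  interpret H: comm_group H by fact
  show "linear_chars H \<subseteq> Irr H"
    by (rule linear_chars_subset_Irr) (rule H.group_axioms)
  show "Irr H \<subseteq> linear_chars H"
  proof
    fix \<phi> assume "\<phi> \<in> Irr H"
    then obtain n \<rho> where irr: "irreducible_rep H n \<rho>" and \<phi>: "\<phi> = character H \<rho>"
      by (auto simp: Irr_def)
    have n: "n > 0" and rep: "matrix_rep H n \<rho>"
      using irr by (auto simp: irreducible_rep_def)
    note rho = rep[unfolded matrix_rep_iff[OF H.group_axioms]]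
    have "\<exists>c. \<rho> h = c \<cdot>\<^sub>m 1\<^sub>m n" if "h \<in> carrier H" for h
      by (rule central_scalar[OF H.group_axioms irr that]) (use H.m_comm that in auto)
    then obtain c where c: "\<And>h. h \<in> carrier H \<Longrightarrow> \<rho> h = c h \<cdot>\<^sub>m 1\<^sub>m n"
      by metis
    let ?W = "{v \<in> carrier_vec n :: complex vec set. \<forall>i\<in>{0<..<n}. v $ i = 0}"
    have "VectorSpace.subspace class_ring ?W (module_vec TYPE(complex) n)"
      by (rule subspace_carrier_vecI) auto
    moreover have "\<rho> h *\<^sub>v w \<in> ?W" if "h \<in> carrier H" "w \<in> ?W" for h w
    proof -
      have "w \<in> carrier_vec n" "dim_vec w = n"
        using that by auto
      then have "\<rho> h *\<^sub>v w = c h \<cdot>\<^sub>v w"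
        using that by (intro eq_vecI) (simp_all add: c carrier_vecD)
      then show ?thesis
        using that by auto
    qed
    ultimately have "invariant_subspace H n \<rho> ?W"
      unfolding invariant_subspace_def by blast
    then have "?W = {0\<^sub>v n} \<or> ?W = carrier_vec n"
      using irr unfolding irreducible_rep_def by blast
    moreover have "unit_vec n 0 \<in> ?W" "unit_vec n 0 \<noteq> (0\<^sub>v n :: complex vec)"
      using n by auto
    ultimately have W: "?W = carrier_vec n"
      by blast
    have "n = 1"
    proof (rule ccontr)
      assume "n \<noteq> 1"
      then have "1 < n"
        using n by simp
      moreover have "unit_vec n 1 \<in> ?W"
        unfolding W by simp
      ultimately show False
        by (auto dest!: bspec[of _ _ "Suc 0"])
    qed
    then have \<phi>_entry: "\<phi> h = \<rho> h $$ (0, 0)" if "h \<in> carrier H" for h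
      using rho that by (auto simp: \<phi> character_def mat_trace_def)
    have "\<phi> (g \<otimes>\<^bsub>H\<^esub> h) = \<phi> g * \<phi> h" if gh: "g \<in> carrier H" "h \<in> carrier H" for g h
    proof -
      have "\<rho> g \<in> carrier_mat 1 1" "\<rho> h \<in> carrier_mat 1 1"
        using rho gh \<open>n = 1\<close> by auto
      then show ?thesis
        using rho gh by (simp add: \<phi>_entry scalar_prod_def)
    qed
    moreover have "\<phi> \<one>\<^bsub>H\<^esub> = 1"
      using rho \<open>n = 1\<close> by (simp add: \<phi>_entry)
    moreover have "\<phi> \<in> extensional (carrier H)"
      by (simp add: \<phi> character_def)
    ultimately show "\<phi> \<in> linear_chars H"
      by (simp add: linear_chars_def)
  qed
qed

section \<open>Values of linear characters and their isotypic projections\<close>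

context group
begin

lemma sum_translate:
  assumes "g \<in> carrier G"
  shows "(\<Sum>h\<in>carrier G. f (g \<otimes> h)) = (\<Sum>h\<in>carrier G. f h)"
  using assms
  by (intro sum.reindex_bij_witness[where i = "\<lambda>h. inv g \<otimes> h" and j = "\<lambda>h. g \<otimes> h"])
    (auto simp flip: m_assoc)

text \<open>The values are roots of unity, hence have absolute value 1, and conjugating them is
  inverting them.\<close>

lemma linear_char_norm:
  assumes fin: "finite (carrier G)" and "\<mu> \<in> linear_chars G" "x \<in> carrier G"
  shows linear_char_power_order: "\<mu> x ^ Coset.order G = 1" and "\<mu> x * cnj (\<mu> x) = 1" "cnj (\<mu> x) = \<mu> (inv x)"
proof -
  have mult: "\<mu> (y \<otimes> z) = \<mu> y * \<mu> z" if "y \<in> carrier G" "z \<in> carrier G" for y z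
    using assms(2) that by (simp add: linear_chars_def)
  have pow: "\<mu> (x [^] k) = \<mu> x ^ k" for k :: nat
    using assms(2,3) by (induction k) (auto simp: linear_chars_def)
  show *: "\<mu> x ^ Coset.order G = 1"
    using pow[of "Coset.order G"] pow_order_eq_1[OF assms(3)] assms(2) by (simp add: linear_chars_def)
  have "Coset.order G > 0"
    using fin order_gt_0_iff_finite by simp
  then have "norm (\<mu> x) = 1"
    using power_eq_imp_eq_base[of "norm (\<mu> x)" "Coset.order G" 1] * by (simp flip: norm_power)
  then show **: "\<mu> x * cnj (\<mu> x) = 1"
    by (simp add: complex_norm_square[symmetric])
  have "\<mu> x * \<mu> (inv x) = \<mu> (x \<otimes> inv x)"
    by (rule mult[symmetric]) (use assms in auto)
  then have "\<mu> x * \<mu> (inv x) = 1"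
    using assms(2,3) by (simp add: linear_chars_def)
  then have "\<mu> x * cnj (\<mu> x) = \<mu> x * \<mu> (inv x)" "\<mu> x \<noteq> 0"
    using ** by auto
  then show "cnj (\<mu> x) = \<mu> (inv x)"
    by simp
qed

text \<open>
  Up to a scalar, \<open>\<Sum>h. cnj (\<mu> h) \<rho>(h)\<close> is the idempotent projecting to the \<open>\<mu>\<close>-isotypic part, so it
  cannot have trace zero unless it vanishes.
\<close>

lemma linear_constituent:
  assumes fin: "finite (carrier G)" and \<mu>: "\<mu> \<in> linear_chars G" and rep: "matrix_rep G n \<rho>"
    and ij: "i < n" "j < n" and nz: "(\<Sum>h\<in>carrier G. cnj (\<mu> h) * \<rho> h $$ (i, j)) \<noteq> 0"
  shows "(\<Sum>h\<in>carrier G. cnj (\<mu> h) * mat_trace (\<rho> h)) \<noteq> 0"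
proof
  assume tr0: "(\<Sum>h\<in>carrier G. cnj (\<mu> h) * mat_trace (\<rho> h)) = 0"
  note rho = rep[unfolded matrix_rep_iff[OF group_axioms]]
  let ?N = "of_nat (Coset.order G) :: complex"
  have N: "?N \<noteq> 0"
    using fin order_gt_0_iff_finite by simp
  define e where "e k l = (\<Sum>h\<in>carrier G. cnj (\<mu> h) * \<rho> h $$ (k, l))" for k l
  define E where "E = mat n n (\<lambda>(k, l). e k l / ?N)"
  have E: "E \<in> carrier_mat n n"
    by (simp add: E_def)
  \<comment> \<open>Multiplying out gives a double sum over \<open>g\<close> and \<open>h\<close> of
    terms that depend only on \<open>g \<otimes> h\<close>; for each fixed \<open>g\<close>,
    translation turns the inner sum into one copy of \<open>e k l\<close>.\<close>
  have ee: "(\<Sum>m<n. e k m * e m l) = ?N * e k l" if kl: "k < n" "l < n" for k l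
  proof -
    have "(\<Sum>m<n. e k m * e m l) =
        (\<Sum>m<n. \<Sum>g\<in>carrier G. \<Sum>h\<in>carrier G. (cnj (\<mu> g) * \<rho> g $$ (k, m)) * (cnj (\<mu> h) * \<rho> h $$ (m, l)))"
      by (simp add: e_def sum_product)
    also have "\<dots> = (\<Sum>g\<in>carrier G. \<Sum>m<n. \<Sum>h\<in>carrier G. (cnj (\<mu> g) * \<rho> g $$ (k, m)) * (cnj (\<mu> h) * \<rho> h $$ (m, l)))"
      by (rule sum.swap)
    also have "\<dots> = (\<Sum>g\<in>carrier G. \<Sum>h\<in>carrier G. \<Sum>m<n. (cnj (\<mu> g) * \<rho> g $$ (k, m)) * (cnj (\<mu> h) * \<rho> h $$ (m, l)))"
      by (rule sum.cong[OF refl], rule sum.swap)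
    also have "\<dots> = (\<Sum>g\<in>carrier G. \<Sum>h\<in>carrier G. cnj (\<mu> (g \<otimes> h)) * \<rho> (g \<otimes> h) $$ (k, l))"
    proof (intro sum.cong refl)
      fix g h assume gh: "g \<in> carrier G" "h \<in> carrier G"
      have "\<rho> g \<in> carrier_mat n n" "\<rho> h \<in> carrier_mat n n" "\<rho> (g \<otimes> h) = \<rho> g * \<rho> h"
        using rho gh by blast+
      moreover have "\<mu> (g \<otimes> h) = \<mu> g * \<mu> h"
        using \<mu> gh by (simp add: linear_chars_def)
      ultimately show "(\<Sum>m<n. (cnj (\<mu> g) * \<rho> g $$ (k, m)) * (cnj (\<mu> h) * \<rho> h $$ (m, l))) =
          cnj (\<mu> (g \<otimes> h)) * \<rho> (g \<otimes> h) $$ (k, l)"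
        using kl by (simp add: mat_mult_entry[of _ n n _ n] sum_distrib_left mult_ac del: index_mult_mat)
    qed
    also have "\<dots> = (\<Sum>g\<in>carrier G. e k l)"
      unfolding e_def by (intro sum.cong refl sum_translate)
    finally show ?thesis
      by (simp add: Coset.order_def)
  qed
  have "E * E = E"
  proof (rule eq_matI)
    fix k l assume "k < dim_row E" "l < dim_col E"
    then have kl: "k < n" "l < n"
      by (auto simp: E_def)
    have "(E * E) $$ (k, l) = (\<Sum>m<n. (e k m / ?N) * (e m l / ?N))"
      using kl mat_mult_entry[OF E E kl] by (simp add: E_def)
    also have "\<dots> = (\<Sum>m<n. e k m * e m l) / (?N * ?N)"
      by (simp add: sum_divide_distrib)
    also have "\<dots> = E $$ (k, l)"
      using N kl by (simp add: ee E_def)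
    finally show "(E * E) $$ (k, l) = E $$ (k, l)" .
  qed (simp_all add: E_def)
  moreover have "mat_trace E = 0"
  proof -
    have "(\<Sum>k<n. e k k) = (\<Sum>h\<in>carrier G. \<Sum>k<n. cnj (\<mu> h) * \<rho> h $$ (k, k))"
      unfolding e_def by (rule sum.swap)
    also have "\<dots> = (\<Sum>h\<in>carrier G. cnj (\<mu> h) * mat_trace (\<rho> h))"
    proof (rule sum.cong[OF refl])
      fix h assume "h \<in> carrier G"
      then have "dim_row (\<rho> h) = n"
        using rho carrier_matD(1) by blast
      then show "(\<Sum>k<n. cnj (\<mu> h) * \<rho> h $$ (k, k)) = cnj (\<mu> h) * mat_trace (\<rho> h)"
        by (simp add: mat_trace_def sum_distrib_left)
    qed
    finally have "(\<Sum>k<n. e k k) = 0"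
      using tr0 by simp
    moreover have "mat_trace E = (\<Sum>k<n. e k k) / ?N"
      by (simp add: mat_trace_def E_def sum_divide_distrib)
    ultimately show ?thesis
      by simp
  qed
  ultimately have "E = 0\<^sub>m n n"
    by (rule idempotent_trace_0[OF E])
  then have "E $$ (i, j) = 0"
    using ij by simp
  then have "e i j = 0"
    using ij N by (simp add: E_def)
  then show False
    using nz by (simp add: e_def)
qed

end

section \<open>Counting the linear characters of a finite abelian group\<close>

context comm_group
begin

lemma finite_linear_chars:
  assumes fin: "finite (carrier G)"
  shows "finite (linear_chars G)"
proof (rule finite_subset)
  have "Coset.order G > 0"
    using fin order_gt_0_iff_finite by simp
  then show "finite (carrier G \<rightarrow>\<^sub>E {z :: complex. z ^ Coset.order G = 1})"
    using fin by (intro finite_PiE finite_nth_roots)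
  show "linear_chars G \<subseteq> carrier G \<rightarrow>\<^sub>E {z. z ^ Coset.order G = 1}"
    using linear_char_power_order[OF fin] by (force simp: linear_chars_def intro: extensional_arb)
qed

lemma exists_linear_char_neq_1:
  assumes fin: "finite (carrier G)" and x: "x \<in> carrier G" "x \<noteq> \<one>"
  obtains \<mu> where "\<mu> \<in> linear_chars G" "\<mu> x \<noteq> 1"
proof -
  \<comment> \<open>With this choice the sum becomes the difference of the character values at
    \<open>\<one>\<close> and at \<open>x\<close>, so a nonzero sum means that the character
    separates the two.\<close>
  define f :: "'a \<Rightarrow> complex" where "f g = (if g = \<one> then 1 else if g = x then -1 else 0)" for g
  have "f \<one> \<noteq> 0"
    by (simp add: f_def)
  then obtain m \<sigma> where irr: "irreducible_rep G m \<sigma>" and nz: "(\<Sum>g\<in>carrier G. f g * mat_trace (\<sigma> g)) \<noteq> 0"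
    using exists_irreducible_rep[OF group_axioms fin] by blast
  have "(\<Sum>g\<in>carrier G. f g * mat_trace (\<sigma> g)) = (\<Sum>g\<in>{\<one>, x}. f g * mat_trace (\<sigma> g))"
    using fin x by (intro sum.mono_neutral_right) (auto simp: f_def)
  also have "\<dots> = mat_trace (\<sigma> \<one>) - mat_trace (\<sigma> x)"
    using x by (simp add: f_def)
  finally have "character G \<sigma> \<one> \<noteq> character G \<sigma> x"
    using nz x by (simp add: character_def)
  moreover have "character G \<sigma> \<in> linear_chars G"
    using irr Irr_comm_group[OF comm_group_axioms] by (auto simp: Irr_def)
  ultimately show thesis
    using that[of "character G \<sigma>"] by (auto simp: linear_chars_def)
qed

text \<open>Multiplication by a character \<open>\<nu>\<close> with
  \<open>\<nu> x \<noteq> 1\<close> permutes the linear characters, its inverse being multiplication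
  by the conjugate of \<open>\<nu>\<close>. So the sum is unchanged when multiplied by
  \<open>\<nu> x\<close>.\<close>

lemma sum_linear_chars:
  assumes fin: "finite (carrier G)" and x: "x \<in> carrier G" "x \<noteq> \<one>"
  shows "(\<Sum>\<mu>\<in>linear_chars G. \<mu> x) = 0"
proof -
  obtain \<nu> where \<nu>: "\<nu> \<in> linear_chars G" "\<nu> x \<noteq> 1"
    using exists_linear_char_neq_1[OF fin x] .
  note norm = linear_char_norm(2)[OF fin \<nu>(1)]
  have mult: "\<nu> z * (cnj (\<nu> z) * w) = w" "cnj (\<nu> z) * (\<nu> z * w) = w" if "z \<in> carrier G" for z w
    using norm[OF that] by (metis mult.assoc mult.commute mult_1)+
  have "(\<Sum>\<mu>\<in>linear_chars G. \<nu> x * \<mu> x) = (\<Sum>\<mu>\<in>linear_chars G. \<mu> x)"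
    using \<nu>(1) x(1)
    by (intro sum.reindex_bij_witness[where i = "\<lambda>\<mu>. \<lambda>z\<in>carrier G. cnj (\<nu> z) * \<mu> z"
          and j = "\<lambda>\<mu>. \<lambda>z\<in>carrier G. \<nu> z * \<mu> z"])
      (auto simp: linear_chars_def mult fun_eq_iff restrict_def extensional_def)
  then have "\<nu> x * (\<Sum>\<mu>\<in>linear_chars G. \<mu> x) = (\<Sum>\<mu>\<in>linear_chars G. \<mu> x)"
    by (simp add: sum_distrib_left)
  then show ?thesis
    using \<nu>(2) by simp
qed

text \<open>Double counting of the sum of \<open>\<mu> x\<close> over all \<open>\<mu>\<close> and
  \<open>x\<close>: summed over \<open>\<mu>\<close> first, only \<open>x = \<one>\<close>
  contributes; summed over \<open>x\<close> first, only the trivial character does.\<close>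

lemma card_linear_chars:
  assumes fin: "finite (carrier G)"
  shows "card (linear_chars G) = Coset.order G"
proof -
  let ?one = "\<lambda>z\<in>carrier G. 1 :: complex"
  have one: "?one \<in> linear_chars G"
    by (auto simp: linear_chars_def)
  have sum_0: "(\<Sum>x\<in>carrier G. \<mu> x) = 0" if \<mu>: "\<mu> \<in> linear_chars G" "\<mu> \<noteq> ?one" for \<mu>
  proof -
    obtain y where y: "y \<in> carrier G" "\<mu> y \<noteq> 1"
    proof (rule ccontr)
      assume "\<not> thesis"
      then have "\<mu> = ?one"
        using \<mu>(1) that by (intro extensionalityI[of _ "carrier G"]) (auto simp: linear_chars_def)
      then show False
        using \<mu>(2) by simp
    qed
    have "\<mu> y * (\<Sum>x\<in>carrier G. \<mu> x) = (\<Sum>x\<in>carrier G. \<mu> (y \<otimes> x))"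
      using \<mu>(1) y(1) by (simp add: sum_distrib_left linear_chars_def)
    also have "\<dots> = (\<Sum>x\<in>carrier G. \<mu> x)"
      by (rule sum_translate[OF y(1)])
    finally show ?thesis
      using y(2) by simp
  qed
  have "of_nat (card (linear_chars G)) = (\<Sum>\<mu>\<in>linear_chars G. \<mu> \<one>)"
    by (simp add: linear_chars_def)
  also have "\<dots> = (\<Sum>x\<in>carrier G. \<Sum>\<mu>\<in>linear_chars G. \<mu> x)"
    using fin sum_linear_chars[OF fin] by (subst sum.remove[OF fin one_closed]) auto
  also have "\<dots> = (\<Sum>\<mu>\<in>linear_chars G. \<Sum>x\<in>carrier G. \<mu> x)"
    by (rule sum.swap)
  also have "\<dots> = (\<Sum>x\<in>carrier G. ?one x)"
    using finite_linear_chars[OF fin] one sum_0 by (subst sum.remove[OF finite_linear_chars[OF fin] one]) auto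
  also have "\<dots> = of_nat (Coset.order G)"
    by (simp add: Coset.order_def)
  finally show ?thesis
    by (simp only: of_nat_eq_iff)
qed

end

text \<open>Summed over all linear characters \<open>\<mu>\<close> of \<open>A\<close>, the inner
  products give the conjugate of the degree \<open>\<phi> \<one>\<close>, since only the identity
  survives the sum over \<open>\<mu>\<close>. This is nonzero, hence so is some summand.\<close>

lemma (in group) linear_char_below:
  assumes fin: "finite (carrier G)" and A: "subgroup A G" and comm: "comm_group (G\<lparr>carrier := A\<rparr>)"
    and \<phi>: "\<phi> \<in> Irr G"
  obtains \<mu> where "\<mu> \<in> linear_chars (G\<lparr>carrier := A\<rparr>)" "char_inner A \<mu> (restrict \<phi> A) \<noteq> 0"
proof -
  interpret A: comm_group "G\<lparr>carrier := A\<rparr>" by fact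
  have AG: "A \<subseteq> carrier G" and finA: "finite A" and oneA: "\<one> \<in> A"
    using subgroup.subset[OF A] subgroup.one_closed[OF A] fin finite_subset by blast+
  let ?L = "linear_chars (G\<lparr>carrier := A\<rparr>)"
  have "(\<Sum>\<mu>\<in>?L. char_inner A \<mu> (restrict \<phi> A)) = (\<Sum>\<mu>\<in>?L. \<Sum>a\<in>A. \<mu> a * cnj (\<phi> a)) / of_nat (card A)"
    by (simp add: char_inner_def sum_divide_distrib)
  also have "(\<Sum>\<mu>\<in>?L. \<Sum>a\<in>A. \<mu> a * cnj (\<phi> a)) = (\<Sum>a\<in>A. \<Sum>\<mu>\<in>?L. \<mu> a * cnj (\<phi> a))"
    by (rule sum.swap)
  also have "\<dots> = (\<Sum>a\<in>A. (\<Sum>\<mu>\<in>?L. \<mu> a) * cnj (\<phi> a))"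
    by (simp add: sum_distrib_right)
  also have "\<dots> = (\<Sum>\<mu>\<in>?L. \<mu> \<one>) * cnj (\<phi> \<one>)"
    using A.sum_linear_chars finA oneA by (subst sum.remove[OF finA oneA]) auto
  also have "(\<Sum>\<mu>\<in>?L. \<mu> \<one>) = of_nat (card A)"
    using A.card_linear_chars finA by (simp add: linear_chars_def Coset.order_def)
  finally have "(\<Sum>\<mu>\<in>?L. char_inner A \<mu> (restrict \<phi> A)) = of_nat (card A) * cnj (\<phi> \<one>) / of_nat (card A)" .
  moreover have "of_nat (card A) * cnj (\<phi> \<one>) / of_nat (card A) \<noteq> 0"
    using Irr_one_neq_0[OF group_axioms \<phi>] finA oneA by auto
  ultimately have "(\<Sum>\<mu>\<in>?L. char_inner A \<mu> (restrict \<phi> A)) \<noteq> 0"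
    by metis
  then obtain \<mu> where "\<mu> \<in> ?L" "char_inner A \<mu> (restrict \<phi> A) \<noteq> 0"
    by (meson sum.neutral)
  then show thesis
    using that by blast
qed

text \<open>
  The element \<open>(\<Sum>a. cnj (\<mu> a) a) (\<Sum>b. cnj (\<nu> b) b)\<close> of the group algebra has coefficient
  \<open>card (A \<inter> B)\<close> at the identity, so its trace on the regular representation is nonzero; hence
  some irreducible representation is annihilated by neither factor.
\<close>

lemma (in group) Irr_above_two_linear_chars:
  assumes fin: "finite (carrier G)" and A: "subgroup A G" and B: "subgroup B G"
    and \<mu>: "\<mu> \<in> linear_chars (G\<lparr>carrier := A\<rparr>)" and \<nu>: "\<nu> \<in> linear_chars (G\<lparr>carrier := B\<rparr>)"
    and agree: "\<And>x. x \<in> A \<inter> B \<Longrightarrow> \<mu> x = \<nu> x"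
  obtains \<psi> where "\<psi> \<in> Irr G" "char_inner A \<mu> (restrict \<psi> A) \<noteq> 0" "char_inner B \<nu> (restrict \<psi> B) \<noteq> 0"
proof -
  interpret A: group "G\<lparr>carrier := A\<rparr>" by (rule subgroup.subgroup_is_group[OF A group_axioms])
  interpret B: group "G\<lparr>carrier := B\<rparr>" by (rule subgroup.subgroup_is_group[OF B group_axioms])
  have AG: "A \<subseteq> carrier G" and finA: "finite A" and oneA: "\<one> \<in> A"
    using subgroup.subset[OF A] subgroup.one_closed[OF A] fin finite_subset by blast+
  have BG: "B \<subseteq> carrier G" and finB: "finite B" and oneB: "\<one> \<in> B"
    using subgroup.subset[OF B] subgroup.one_closed[OF B] fin finite_subset by blast+
  \<comment> \<open>The coefficients of the product of the two group algebra elements.\<close>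
  define f where "f g = (\<Sum>a\<in>A. \<Sum>b\<in>B. if a \<otimes> b = g then cnj (\<mu> a) * cnj (\<nu> b) else 0)" for g
  have sum_f: "(\<Sum>g\<in>carrier G. f g * t g) = (\<Sum>a\<in>A. \<Sum>b\<in>B. cnj (\<mu> a) * cnj (\<nu> b) * t (a \<otimes> b))"
    for t :: "'a \<Rightarrow> complex"
  proof -
    have "(\<Sum>g\<in>carrier G. f g * t g) =
        (\<Sum>g\<in>carrier G. \<Sum>a\<in>A. \<Sum>b\<in>B. if a \<otimes> b = g then cnj (\<mu> a) * cnj (\<nu> b) * t g else 0)"
      unfolding f_def sum_distrib_right by (intro sum.cong refl) auto
    also have "\<dots> = (\<Sum>a\<in>A. \<Sum>g\<in>carrier G. \<Sum>b\<in>B. if a \<otimes> b = g then cnj (\<mu> a) * cnj (\<nu> b) * t g else 0)"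
      by (rule sum.swap)
    also have "\<dots> = (\<Sum>a\<in>A. \<Sum>b\<in>B. \<Sum>g\<in>carrier G. if a \<otimes> b = g then cnj (\<mu> a) * cnj (\<nu> b) * t g else 0)"
      by (rule sum.cong[OF refl], rule sum.swap)
    also have "\<dots> = (\<Sum>a\<in>A. \<Sum>b\<in>B. cnj (\<mu> a) * cnj (\<nu> b) * t (a \<otimes> b))"
      using fin AG BG by (intro sum.cong refl) (auto simp: subset_iff)
    finally show ?thesis .
  qed
  \<comment> \<open>Only \<open>b = inv a\<close> contributes. If it lies in \<open>B\<close>, then
    so does \<open>a\<close>, and the agreement of \<open>\<mu>\<close> and \<open>\<nu>\<close> at
    \<open>a\<close> makes the term equal to 1.\<close>
  have inner: "(\<Sum>b\<in>B. if a \<otimes> b = \<one> then cnj (\<mu> a) * cnj (\<nu> b) else 0) = (if a \<in> B then 1 else 0)"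
    if a: "a \<in> A" for a
  proof -
    have aG: "a \<in> carrier G"
      using a AG by blast
    have inv_iff: "a \<otimes> b = \<one> \<longleftrightarrow> b = inv a" if "b \<in> B" for b
      using that aG BG inv_equality[of b a] by (metis inv_inv r_inv subsetD inv_equality)
    have "(\<Sum>b\<in>B. if a \<otimes> b = \<one> then cnj (\<mu> a) * cnj (\<nu> b) else 0) =
        (\<Sum>b\<in>B. if b = inv a then cnj (\<mu> a) * cnj (\<nu> b) else 0)"
      by (intro sum.cong) (simp_all add: inv_iff)
    also have "\<dots> = (if inv a \<in> B then cnj (\<mu> a) * cnj (\<nu> (inv a)) else 0)"
      using finB by simp
    also have "\<dots> = (if a \<in> B then 1 else 0)"
    proof (cases "a \<in> B")
      case True
      have "cnj (\<nu> a) = \<nu> (inv a)"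
        using B.linear_char_norm(3)[of \<nu> a] finB \<nu> True m_inv_consistent[OF B] by simp
      moreover have "\<nu> a * cnj (\<nu> a) = 1"
        using B.linear_char_norm(2)[of \<nu> a] finB \<nu> True by simp
      ultimately have "cnj (\<mu> a) * cnj (\<nu> (inv a)) = 1"
        using agree[of a] a True by (metis IntI complex_cnj_cnj mult.commute)
      then show ?thesis
        using True subgroup.m_inv_closed[OF B] by simp
    next
      case False
      then have "inv a \<notin> B"
        using subgroup.m_inv_closed[OF B, of "inv a"] aG by auto
      then show ?thesis
        using False by simp
    qed
    finally show ?thesis .
  qed
  have "f \<one> = of_nat (card (A \<inter> B))"
    using finA by (simp add: f_def inner sum.If_cases Int_def)
  moreover have "card (A \<inter> B) \<noteq> 0"
    using finA oneA oneB by auto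
  ultimately have "f \<one> \<noteq> 0"
    by simp
  then obtain n \<sigma> where irr: "irreducible_rep G n \<sigma>" and nz: "(\<Sum>g\<in>carrier G. f g * mat_trace (\<sigma> g)) \<noteq> 0"
    using exists_irreducible_rep[OF group_axioms fin] by blast
  have rep: "matrix_rep G n \<sigma>"
    using irr by (simp add: irreducible_rep_def)
  note sigma = rep[unfolded matrix_rep_iff[OF group_axioms]]
  \<comment> \<open>The trace of the product is the sum of \<open>eA i j * eB j i\<close>. One
    nonzero summand gives a nonzero entry of each factor, and \<open>linear_constituent\<close>
    turns each entry into a nonzero trace.\<close>
  define eA where "eA i j = (\<Sum>a\<in>A. cnj (\<mu> a) * \<sigma> a $$ (i, j))" for i j
  define eB where "eB i j = (\<Sum>b\<in>B. cnj (\<nu> b) * \<sigma> b $$ (i, j))" for i j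
  have tr: "mat_trace (\<sigma> (a \<otimes> b)) = (\<Sum>i<n. \<Sum>j<n. \<sigma> a $$ (i, j) * \<sigma> b $$ (j, i))"
    if "a \<in> A" "b \<in> B" for a b
  proof -
    have ab: "\<sigma> a \<in> carrier_mat n n" "\<sigma> b \<in> carrier_mat n n" "\<sigma> (a \<otimes> b) = \<sigma> a * \<sigma> b"
      using sigma that AG BG by blast+
    have "mat_trace (\<sigma> a * \<sigma> b) = (\<Sum>i<n. (\<sigma> a * \<sigma> b) $$ (i, i))"
      using ab by (simp add: mat_trace_def del: index_mult_mat(1))
    also have "\<dots> = (\<Sum>i<n. \<Sum>j<n. \<sigma> a $$ (i, j) * \<sigma> b $$ (j, i))"
      by (intro sum.cong refl mat_mult_entry[OF ab(1,2)]) auto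
    finally show ?thesis
      using ab(3) by simp
  qed
  have "(\<Sum>g\<in>carrier G. f g * mat_trace (\<sigma> g)) =
      (\<Sum>a\<in>A. \<Sum>b\<in>B. \<Sum>i<n. \<Sum>j<n. (cnj (\<mu> a) * \<sigma> a $$ (i, j)) * (cnj (\<nu> b) * \<sigma> b $$ (j, i)))"
    unfolding sum_f by (intro sum.cong refl) (simp add: tr sum_distrib_left mult_ac)
  also have "\<dots> = (\<Sum>a\<in>A. \<Sum>i<n. \<Sum>b\<in>B. \<Sum>j<n. (cnj (\<mu> a) * \<sigma> a $$ (i, j)) * (cnj (\<nu> b) * \<sigma> b $$ (j, i)))"
    by (rule sum.cong[OF refl], rule sum.swap)
  also have "\<dots> = (\<Sum>a\<in>A. \<Sum>i<n. \<Sum>j<n. \<Sum>b\<in>B. (cnj (\<mu> a) * \<sigma> a $$ (i, j)) * (cnj (\<nu> b) * \<sigma> b $$ (j, i)))"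
    by (rule sum.cong[OF refl], rule sum.cong[OF refl], rule sum.swap)
  also have "\<dots> = (\<Sum>i<n. \<Sum>a\<in>A. \<Sum>j<n. \<Sum>b\<in>B. (cnj (\<mu> a) * \<sigma> a $$ (i, j)) * (cnj (\<nu> b) * \<sigma> b $$ (j, i)))"
    by (rule sum.swap)
  also have "\<dots> = (\<Sum>i<n. \<Sum>j<n. \<Sum>a\<in>A. \<Sum>b\<in>B. (cnj (\<mu> a) * \<sigma> a $$ (i, j)) * (cnj (\<nu> b) * \<sigma> b $$ (j, i)))"
    by (rule sum.cong[OF refl], rule sum.swap)
  also have "\<dots> = (\<Sum>i<n. \<Sum>j<n. eA i j * eB j i)"
    by (simp add: eA_def eB_def sum_product)
  finally have "(\<Sum>i<n. \<Sum>j<n. eA i j * eB j i) \<noteq> 0"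
    using nz by simp
  then obtain i where i: "i < n" "(\<Sum>j<n. eA i j * eB j i) \<noteq> 0"
    by (meson lessThan_iff sum.neutral)
  then obtain j where j: "j < n" "eA i j * eB j i \<noteq> 0"
    by (meson lessThan_iff sum.neutral)
  have "(\<Sum>a\<in>A. cnj (\<mu> a) * mat_trace (\<sigma> a)) \<noteq> 0"
    using A.linear_constituent[OF _ \<mu> matrix_rep_subgroup[OF group_axioms A rep] i(1) j(1)] finA j(2)
    by (simp add: eA_def)
  moreover have "char_inner A \<mu> (restrict (character G \<sigma>) A) =
      cnj (\<Sum>x\<in>A. cnj (\<mu> x) * mat_trace (\<sigma> x)) / of_nat (card A)"
    using AG by (simp add: char_inner_def character_def subset_iff)
  ultimately have \<mu>_inner: "char_inner A \<mu> (restrict (character G \<sigma>) A) \<noteq> 0"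
    using finA oneA by (simp del: cnj_sum) auto
  have "(\<Sum>b\<in>B. cnj (\<nu> b) * mat_trace (\<sigma> b)) \<noteq> 0"
    using B.linear_constituent[OF _ \<nu> matrix_rep_subgroup[OF group_axioms B rep] j(1) i(1)] finB j(2)
    by (simp add: eB_def)
  moreover have "char_inner B \<nu> (restrict (character G \<sigma>) B) =
      cnj (\<Sum>x\<in>B. cnj (\<nu> x) * mat_trace (\<sigma> x)) / of_nat (card B)"
    using BG by (simp add: char_inner_def character_def subset_iff)
  ultimately have \<nu>_inner: "char_inner B \<nu> (restrict (character G \<sigma>) B) \<noteq> 0"
    using finB oneB by (simp del: cnj_sum) auto
  show thesis
    using that[of "character G \<sigma>"] irr \<mu>_inner \<nu>_inner by (auto simp: Irr_def)
qed

section \<open>Comparison and extension of linear characters\<close>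

context group
begin

text \<open>Translation by \<open>z\<close> multiplies the sum by \<open>a * cnj b\<close>, which
  must therefore be 1. It is used for the central characters of comparable pairs, and also to see
  that a linear character with nonzero inner product against \<open>\<theta>\<close> on a subgroup
  extends \<open>\<theta>\<close>.\<close>

lemma sum_semi_invariant_eq:
  assumes z: "z \<in> carrier G"
    and \<phi>: "\<And>h. h \<in> carrier G \<Longrightarrow> \<phi> (z \<otimes> h) = a * \<phi> h"
    and \<psi>: "\<And>h. h \<in> carrier G \<Longrightarrow> \<psi> (z \<otimes> h) = b * \<psi> h"
    and b: "b * cnj b = 1" and nz: "(\<Sum>h\<in>carrier G. \<phi> h * cnj (\<psi> h)) \<noteq> 0"
  shows "a = b"
proof -
  have "(\<Sum>h\<in>carrier G. \<phi> h * cnj (\<psi> h)) = (\<Sum>h\<in>carrier G. \<phi> (z \<otimes> h) * cnj (\<psi> (z \<otimes> h)))"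
    using sum_translate[OF z, of "\<lambda>h. \<phi> h * cnj (\<psi> h)"] by simp
  also have "\<dots> = (a * cnj b) * (\<Sum>h\<in>carrier G. \<phi> h * cnj (\<psi> h))"
    by (simp add: \<phi> \<psi> sum_distrib_left mult_ac)
  finally have "a * cnj b = 1"
    using nz by simp
  then have "a * (b * cnj b) = b"
    by (simp add: algebra_simps)
  then show ?thesis
    using b by simp
qed

text \<open>An irreducible character of the abelian group \<open>A\<close> above both
  \<open>\<mu>\<close> and \<open>\<nu>\<close> is linear, so lying above them means extending them.
  Taking the same subgroup and character twice gives the extension of a single character.\<close>

lemma extend_linear_chars:
  assumes fin: "finite A" and A: "subgroup A G" and comm: "comm_group (G\<lparr>carrier := A\<rparr>)"
    and X: "subgroup X G" "X \<subseteq> A" and Y: "subgroup Y G" "Y \<subseteq> A"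
    and \<mu>: "\<mu> \<in> linear_chars (G\<lparr>carrier := X\<rparr>)" and \<nu>: "\<nu> \<in> linear_chars (G\<lparr>carrier := Y\<rparr>)"
    and agree: "\<And>x. x \<in> X \<inter> Y \<Longrightarrow> \<mu> x = \<nu> x"
  obtains \<kappa> where "\<kappa> \<in> linear_chars (G\<lparr>carrier := A\<rparr>)" "\<And>x. x \<in> X \<Longrightarrow> \<kappa> x = \<mu> x" "\<And>y. y \<in> Y \<Longrightarrow> \<kappa> y = \<nu> y"
proof -
  interpret A: comm_group "G\<lparr>carrier := A\<rparr>" by fact
  have sub: "subgroup X (G\<lparr>carrier := A\<rparr>)" "subgroup Y (G\<lparr>carrier := A\<rparr>)"
    using subgroup_incl[OF X(1) A X(2)] subgroup_incl[OF Y(1) A Y(2)] .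
  obtain \<psi> where \<psi>: "\<psi> \<in> Irr (G\<lparr>carrier := A\<rparr>)"
    "char_inner X \<mu> (restrict \<psi> X) \<noteq> 0" "char_inner Y \<nu> (restrict \<psi> Y) \<noteq> 0"
    using A.Irr_above_two_linear_chars[OF _ sub, of \<mu> \<nu>] fin \<mu> \<nu> agree by auto
  then have \<psi>_lin: "\<psi> \<in> linear_chars (G\<lparr>carrier := A\<rparr>)"
    using Irr_comm_group[OF comm] by simp
  have eq: "\<psi> z = \<theta> z"
    if W: "subgroup W G" "W \<subseteq> A" and \<theta>: "\<theta> \<in> linear_chars (G\<lparr>carrier := W\<rparr>)"
      and nz: "char_inner W \<theta> (restrict \<psi> W) \<noteq> 0" and z: "z \<in> W" for W \<theta> z
  proof -
    interpret W: group "G\<lparr>carrier := W\<rparr>" by (rule subgroup.subgroup_is_group[OF W(1) group_axioms])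
    have "\<psi> z * cnj (\<psi> z) = 1"
      using A.linear_char_norm(2)[OF _ \<psi>_lin, of z] fin W(2) z by auto
    moreover have "(\<Sum>h\<in>W. \<theta> h * cnj (\<psi> h)) \<noteq> 0"
      using nz by (auto simp: char_inner_def)
    ultimately have "\<theta> z = \<psi> z"
      using W.sum_semi_invariant_eq[of z \<theta> "\<theta> z" \<psi> "\<psi> z"] z W(2) \<theta> \<psi>_lin
      by (auto simp: linear_chars_def subset_iff)
    then show ?thesis ..
  qed
  show thesis
    using that[OF \<psi>_lin] eq[OF X \<mu> \<psi>(2)] eq[OF Y \<nu> \<psi>(3)] by blast
qed

lemma linear_chars_restrict:
  assumes "subgroup X G" "X \<subseteq> A" "\<mu> \<in> linear_chars (G\<lparr>carrier := A\<rparr>)"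
  shows "restrict \<mu> X \<in> linear_chars (G\<lparr>carrier := X\<rparr>)"
  using assms subgroup.one_closed[OF assms(1)] subgroup.m_closed[OF assms(1)]
  by (auto simp: linear_chars_def subset_iff)

end

section \<open>Abelian subgroups of finite p-groups\<close>

context group
begin

definition centralizer :: "'a set \<Rightarrow> 'a set" where
  "centralizer S = {g \<in> carrier G. \<forall>s\<in>S. g \<otimes> s = s \<otimes> g}"

lemma subgroup_centralizer:
  assumes S: "S \<subseteq> carrier G"
  shows "subgroup (centralizer S) G"
proof (rule subgroupI)
  fix g h assume gh: "g \<in> centralizer S" "h \<in> centralizer S"
  have "g \<otimes> h \<otimes> s = s \<otimes> (g \<otimes> h)" if "s \<in> S" for s
  proof -
    have s: "s \<in> carrier G" "g \<in> carrier G" "h \<in> carrier G" "g \<otimes> s = s \<otimes> g" "h \<otimes> s = s \<otimes> h"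
      using gh S that by (auto simp: centralizer_def)
    have "g \<otimes> h \<otimes> s = g \<otimes> s \<otimes> h"
      using s(1-3,5) by (simp add: m_assoc)
    also have "\<dots> = s \<otimes> (g \<otimes> h)"
      unfolding s(4) using s(1-3) by (simp add: m_assoc)
    finally show ?thesis .
  qed
  then show "g \<otimes> h \<in> centralizer S"
    using gh by (auto simp: centralizer_def)
next
  fix g assume g: "g \<in> centralizer S"
  have "inv g \<otimes> s = s \<otimes> inv g" if "s \<in> S" for s
  proof -
    have s: "s \<in> carrier G" "g \<in> carrier G" "g \<otimes> s = s \<otimes> g"
      using g S that by (auto simp: centralizer_def)
    have "inv g \<otimes> s = inv g \<otimes> (s \<otimes> g) \<otimes> inv g"
      using s(1,2) by (simp add: m_assoc)
    also have "\<dots> = inv g \<otimes> (g \<otimes> s) \<otimes> inv g"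
      using s(3) by simp
    also have "\<dots> = s \<otimes> inv g"
      using s(1,2) by (simp add: m_assoc[symmetric])
    finally show ?thesis .
  qed
  then show "inv g \<in> centralizer S"
    using g by (auto simp: centralizer_def)
next
  have "\<one> \<in> centralizer S"
    using S by (auto simp: centralizer_def subset_iff)
  then show "centralizer S \<noteq> {}"
    by blast
qed (auto simp: centralizer_def)

lemma comm_group_subgroupI:
  assumes "subgroup M G" "\<And>x y. x \<in> M \<Longrightarrow> y \<in> M \<Longrightarrow> x \<otimes> y = y \<otimes> x"
  shows "comm_group (G\<lparr>carrier := M\<rparr>)"
  using subgroup.subgroup_is_group[OF assms(1) group_axioms] assms(2)
  by (intro group.group_comm_groupI) auto

end

lemma two_le_exponent:
  fixes p :: nat
  assumes "prime p" "p < p ^ k"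
  shows "2 \<le> k"
proof (rule ccontr)
  assume "\<not> 2 \<le> k"
  then have "k = 0 \<or> k = 1"
    by auto
  then show False
    using assms prime_gt_1_nat[of p] by auto
qed

section \<open>Centers and small subgroups of finite p-groups\<close>

locale finite_p_group = group G for G (structure) +
  fixes p :: nat
  assumes prime: "prime p" and finite: "finite (carrier G)" and order: "\<exists>k. Coset.order G = p ^ k"
begin

lemma p_gt_1: "1 < p"
  by (rule prime_gt_1_nat[OF prime])

lemma card_subgroup:
  assumes "subgroup H G"
  obtains k where "card H = p ^ k"
proof -
  have "card H dvd Coset.order G"
    using lagrange[OF assms] by (metis dvd_triv_right)
  then show thesis
    using that order divides_primepow_nat[OF prime] by auto
qed

lemma finite_p_subgroup:
  assumes "subgroup H G"
  shows "finite_p_group (G\<lparr>carrier := H\<rparr>) p"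
proof -
  obtain k where "card H = p ^ k"
    using card_subgroup[OF assms] .
  then show ?thesis
    using subgroup.subgroup_is_group[OF assms group_axioms] prime finite_subset[OF subgroup.subset[OF assms] finite]
    by (auto simp: finite_p_group_def finite_p_group_axioms_def Coset.order_def)
qed

text \<open>Class equation: a class of more than one element has size a nontrivial power of
  \<open>p\<close>, so \<open>p\<close> divides the number of noncentral elements as well as the
  group order.\<close>

lemma p_dvd_card_center:
  assumes "1 < Coset.order G"
  shows "p dvd card (centralizer (carrier G))"
proof -
  define \<gamma> where "\<gamma> = (\<lambda>g. \<lambda>h\<in>carrier G. g \<otimes> h \<otimes> inv g)"
  interpret conj: group_action G "carrier G" \<gamma>
    unfolding \<gamma>_def by (rule action_by_conjugation)
  let ?Z = "centralizer (carrier G)"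
  let ?O = "orbits G (carrier G) \<gamma>"
  \<comment> \<open>The indicator of the noncentral elements sums to 0 over a singleton orbit and to
    the size of the orbit otherwise.\<close>
  have p_dvd_orbit: "p dvd (\<Sum>x\<in>orb. if x \<in> ?Z then 0 else 1)" if orb: "orb \<in> ?O" for orb
  proof -
    obtain x where x: "x \<in> carrier G" "orb = orbit G \<gamma> x"
      using orb by (auto simp: orbits_def)
    have orb_sub: "orb \<subseteq> carrier G"
      using x by (auto simp: orbit_def \<gamma>_def)
    then have fin_orb: "finite orb"
      using finite finite_subset by blast
    have x_orb: "x \<in> orb"
      using conj.orbit_refl[OF x(1)] x(2) by simp
    show ?thesis
    proof (cases "card orb = 1")
      case True
      then have orb_x: "orb = {x}"
        using x_orb by (metis card_1_singletonE singletonD)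
      have "x \<in> ?Z"
      proof -
        have "g \<otimes> x = x \<otimes> g" if g: "g \<in> carrier G" for g
        proof -
          have "g \<otimes> x \<otimes> inv g \<in> orb"
            using g x by (auto simp: orbit_def \<gamma>_def)
          then have "g \<otimes> x \<otimes> inv g = x"
            using orb_x by simp
          then have "x \<otimes> g = g \<otimes> x \<otimes> inv g \<otimes> g"
            by simp
          also have "\<dots> = g \<otimes> x"
            using g x(1) by (simp add: m_assoc)
          finally show ?thesis ..
        qed
        then show ?thesis
          using x(1) by (simp add: centralizer_def)
      qed
      then show ?thesis
        by (simp add: orb_x)
    next
      case False
      have "z \<notin> ?Z" if "z \<in> orb" for z
      proof
        assume z: "z \<in> ?Z"
        obtain g where g: "g \<in> carrier G" "z = g \<otimes> x \<otimes> inv g"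
          using \<open>z \<in> orb\<close> x by (auto simp: orbit_def \<gamma>_def)
        have zG: "z \<in> carrier G" and comm: "\<And>h. h \<in> carrier G \<Longrightarrow> z \<otimes> h = h \<otimes> z"
          using z by (auto simp: centralizer_def)
        have "g \<otimes> x = z \<otimes> g"
          using g x(1) by (simp add: m_assoc)
        also have "\<dots> = g \<otimes> z"
          by (rule comm[OF g(1)])
        finally have "x = z"
          using g(1) x(1) zG by simp
        then have "x \<in> ?Z"
          using z by simp
        have "\<gamma> h x = x" if h: "h \<in> carrier G" for h
        proof -
          have "h \<otimes> x = x \<otimes> h"
            using \<open>x \<in> ?Z\<close> h by (simp add: centralizer_def)
          then show ?thesis
            using h x(1) by (simp add: \<gamma>_def m_assoc)
        qed
        then have "orb = {x}"
          using x x_orb by (auto simp: orbit_def)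
        then show False
          using False by simp
      qed
      then have "(\<Sum>x\<in>orb. if x \<in> ?Z then 0 else 1 :: nat) = card orb"
        by simp
      moreover have "card orb dvd Coset.order G"
        using conj.orbit_stabilizer_theorem[OF x(1)] x(2) by (metis dvd_triv_left)
      then obtain i where "card orb = p ^ i"
        using order divides_primepow_nat[OF prime] by auto
      then have "p dvd card orb"
        using False by (cases i) auto
      ultimately show ?thesis
        by simp
    qed
  qed
  have "p dvd (\<Sum>orb\<in>?O. \<Sum>x\<in>orb. if x \<in> ?Z then 0 else 1)"
    by (rule dvd_sum) (rule p_dvd_orbit)
  also have "\<dots> = (\<Sum>x\<in>carrier G. if x \<in> ?Z then 0 else 1)"
    by (rule conj.disjoint_sum[OF finite])
  also have "\<dots> = card (carrier G - ?Z)"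
    using finite by (simp add: sum.If_cases Diff_eq)
  also have "\<dots> = Coset.order G - card ?Z"
    using finite by (simp add: Coset.order_def card_Diff_subset centralizer_def)
  finally have "p dvd Coset.order G - card ?Z" .
  moreover have "card ?Z \<le> Coset.order G"
    using finite by (auto simp: Coset.order_def centralizer_def intro: card_mono)
  moreover have "p dvd Coset.order G"
  proof -
    obtain i where "Coset.order G = p ^ i"
      using order by blast
    then show ?thesis
      using assms by (cases i) auto
  qed
  ultimately show ?thesis
    using dvd_diffD1 by blast
qed

text \<open>
  The abelian subgroup is the double centralizer of the center together with one more element,
  chosen outside the center whenever there is one.
\<close>

lemma exists_abelian_subgroup:
  assumes large: "p < Coset.order G" and x: "x \<in> carrier G"
  obtains M where "subgroup M G" "x \<in> M" "p < card M" "comm_group (G\<lparr>carrier := M\<rparr>)"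
proof -
  let ?Z = "centralizer (carrier G)"
  have Z: "subgroup ?Z G"
    by (rule subgroup_centralizer) simp
  have ZG: "?Z \<subseteq> carrier G"
    by (auto simp: centralizer_def)
  \<comment> \<open>A noncentral \<open>x\<close> serves as \<open>y\<close> itself. A central
    \<open>x\<close> already lies in \<open>?Z\<close>, which leaves \<open>y\<close> free to be
    noncentral if the group is not abelian.\<close>
  obtain y where y: "y \<in> carrier G" "x \<in> insert y ?Z" "y \<notin> ?Z \<or> ?Z = carrier G"
    using x ZG by blast
  let ?S = "insert y ?Z"
  define M where "M = centralizer (centralizer ?S)"
  have S: "?S \<subseteq> carrier G"
    using y(1) ZG by blast
  \<comment> \<open>The elements of \<open>?S\<close> commute with each other, so the double
    centralizer lies inside the centralizer, whose elements commute with all of \<open>M\<close>;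
    this makes \<open>M\<close> abelian.\<close>
  have "?S \<subseteq> centralizer ?S"
    using S by (auto simp: centralizer_def)
  then have M_sub: "M \<subseteq> centralizer ?S"
    by (auto simp: M_def centralizer_def)
  have SM: "?S \<subseteq> M"
    using S by (auto simp: M_def centralizer_def)
  have M: "subgroup M G"
    unfolding M_def by (rule subgroup_centralizer) (auto simp: centralizer_def)
  have finM: "finite M"
    using finite subgroup.subset[OF M] finite_subset by blast
  have "u \<otimes> v = v \<otimes> u" if "u \<in> M" "v \<in> M" for u v
  proof -
    have "\<forall>s\<in>centralizer ?S. u \<otimes> s = s \<otimes> u"
      using that(1) unfolding M_def by (subst (asm) centralizer_def) blast
    then show ?thesis
      using M_sub that(2) by blast
  qed
  then have comm: "comm_group (G\<lparr>carrier := M\<rparr>)"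
    by (rule comm_group_subgroupI[OF M])
  have "p dvd card ?Z"
    using large p_gt_1 by (intro p_dvd_card_center) simp
  moreover have "0 < card ?Z"
    using subgroup.one_closed[OF Z] finite_subset[OF ZG finite] by (auto simp: card_gt_0_iff)
  ultimately have pZ: "p \<le> card ?Z"
    by (rule dvd_imp_le)
  have "p < card M"
  proof (cases "?Z = carrier G")
    case True
    then have "M = carrier G"
      using SM subgroup.subset[OF M] by blast
    then show ?thesis
      using large by (simp add: Coset.order_def)
  next
    case False
    then have "?Z \<subset> M"
      using SM y(3) by blast
    then show ?thesis
      using pZ psubset_card_mono[OF finM] by (meson le_less_trans)
  qed
  then show thesis
    using that M comm SM y(2) by blast
qed

text \<open>The form of Sylow's theorem used here allows the cofactor to be divisible by
  \<open>p\<close>, so it applies to \<open>p ^ 2\<close> with cofactor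
  \<open>p ^ (k - 2)\<close>.\<close>

lemma exists_subgroup_order_p2:
  assumes H: "subgroup H G" and "p < card H"
  obtains A where "subgroup A G" "A \<subseteq> H" "card A = p ^ 2"
proof -
  interpret H: finite_p_group "G\<lparr>carrier := H\<rparr>" p
    by (rule finite_p_subgroup[OF H])
  obtain k where k: "card H = p ^ k"
    using card_subgroup[OF H] .
  then have "2 \<le> k"
    using two_le_exponent[OF prime] assms(2) by simp
  then have "p ^ k = p ^ 2 * p ^ (k - 2)"
    by (metis le_add_diff_inverse power_add)
  then have "Coset.order (G\<lparr>carrier := H\<rparr>) = p ^ 2 * p ^ (k - 2)"
    using k by (simp add: Coset.order_def)
  then obtain A where "subgroup A (G\<lparr>carrier := H\<rparr>)" "card A = p ^ 2"
    using sylow_thm[OF prime H.group_axioms _ H.finite] by blast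
  then show thesis
    using that incl_subgroup[OF H] subgroup.subset[of A "G\<lparr>carrier := H\<rparr>"] by auto
qed

text \<open>The abelian subgroup of order greater than \<open>p\<close> found inside
  \<open>A\<close> has order a power of \<open>p\<close>, so it is all of \<open>A\<close>.\<close>

lemma comm_group_order_p2:
  assumes A: "subgroup A G" "card A = p ^ 2"
  shows "comm_group (G\<lparr>carrier := A\<rparr>)"
proof (rule comm_group_subgroupI[OF A(1)])
  interpret A: finite_p_group "G\<lparr>carrier := A\<rparr>" p
    by (rule finite_p_subgroup[OF A(1)])
  have p2: "p < p ^ 2"
    using p_gt_1 by (simp add: power2_eq_square)
  fix x y assume x: "x \<in> A" and y: "y \<in> A"
  obtain M where M: "subgroup M (G\<lparr>carrier := A\<rparr>)" "p < card M" "comm_group (G\<lparr>carrier := M\<rparr>)"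
    using A.exists_abelian_subgroup[of x] x A(2) p2 by (auto simp: Coset.order_def)
  obtain k where k: "card M = p ^ k"
    using A.card_subgroup[OF M(1)] .
  then have "2 \<le> k"
    using two_le_exponent[OF prime] M(2) by simp
  then have "card A \<le> card M"
    using A(2) k p_gt_1 by (simp add: power_increasing)
  moreover have "M \<subseteq> A"
    using subgroup.subset[OF M(1)] by simp
  ultimately have "M = A"
    using A.finite card_seteq by auto
  then show "x \<otimes> y = y \<otimes> x"
    using comm_monoid.m_comm[OF comm_group.axioms(1)[OF M(3)]] x y by simp
qed

end

section \<open>Components of the poset of characters\<close>

text \<open>The components are the fibres of the invariant \<open>F\<close>: \<open>mono\<close>
  keeps each component inside a fibre, and \<open>conn\<close> joins the points of a fibre. Fibres
  over distinct elements of \<open>Y\<close> are distinct because none is empty.\<close>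

lemma card_poset_components:
  assumes "F ` X = Y" and mono: "\<And>x y. (x, y) \<in> r \<Longrightarrow> F x = F y"
    and conn: "\<And>x y. x \<in> X \<Longrightarrow> y \<in> X \<Longrightarrow> F x = F y \<Longrightarrow> (x, y) \<in> ((r \<union> r\<inverse>) \<inter> X \<times> X)\<^sup>*"
  shows "card (poset_components X r) = card Y"
proof -
  let ?R = "((r \<union> r\<inverse>) \<inter> X \<times> X)\<^sup>*"
  have F_eq: "F x = F y \<and> y \<in> X" if "(x, y) \<in> ?R" "x \<in> X" for x y
    using that(1)
  proof (induction rule: rtrancl_induct)
    case (step y z)
    have "F y = F z"
      using step.hyps(2) mono[of y z] mono[of z y] by auto
    then show ?case
      using step.IH step.hyps(2) by simp
  qed (use that(2) in simp)
  have cls: "?R `` {x} = {y \<in> X. F y = F x}" if x: "x \<in> X" for x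
  proof (intro equalityI subsetI)
    fix y assume "y \<in> ?R `` {x}"
    then show "y \<in> {y \<in> X. F y = F x}"
      using F_eq[of x y] x by simp
  next
    fix y assume "y \<in> {y \<in> X. F y = F x}"
    then show "y \<in> ?R `` {x}"
      using conn[of x y] x by simp
  qed
  have "poset_components X r = (\<lambda>x. ?R `` {x}) ` X"
    unfolding poset_components_def quotient_def by blast
  also have "\<dots> = (\<lambda>x. {y \<in> X. F y = F x}) ` X"
    by (rule image_cong[OF refl cls])
  also have "\<dots> = (\<lambda>c. {y \<in> X. F y = c}) ` Y"
    unfolding assms(1)[symmetric] image_image ..
  finally have "poset_components X r = (\<lambda>c. {y \<in> X. F y = c}) ` Y" .
  moreover have "inj_on (\<lambda>c. {y \<in> X. F y = c}) Y"
    using assms(1) by (auto simp: inj_on_def)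
  ultimately show ?thesis
    by (simp add: card_image)
qed

section \<open>The intersection I and the central characters of pairs\<close>

locale large_finite_p_group = finite_p_group +
  assumes large: "p ^ 2 \<le> Coset.order G"
begin

abbreviation I where "I \<equiv> inter_order_p2 p G"

abbreviation \<Gamma> where "\<Gamma> \<equiv> Gamma1 p G"

definition linked :: "('a set \<times> ('a \<Rightarrow> complex)) rel" where
  "linked = ((Gamma1_le p G \<union> (Gamma1_le p G)\<inverse>) \<inter> \<Gamma> \<times> \<Gamma>)\<^sup>*"

definition order_p2 :: "'a set set" where
  "order_p2 = {A. subgroup A G \<and> card A = p ^ 2}"

lemma I_eq: "I = \<Inter> order_p2"
  by (simp add: inter_order_p2_def order_p2_def)

lemma p_less_p2: "p < p ^ 2"
  using p_gt_1 by (simp add: power2_eq_square)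

lemma p_less_order: "p < Coset.order G"
  using p_less_p2 large by linarith

lemma exists_order_p2_below:
  assumes "subgroup H G" "p < card H"
  obtains A where "A \<in> order_p2" "A \<subseteq> H"
proof -
  obtain A where "subgroup A G" "A \<subseteq> H" "card A = p ^ 2"
    using exists_subgroup_order_p2[OF assms] .
  then show thesis
    using that by (simp add: order_p2_def)
qed

lemma exists_order_p2: obtains A where "A \<in> order_p2"
proof -
  have "p < card (carrier G)"
    using p_less_order by (simp add: Coset.order_def)
  then show thesis
    using exists_order_p2_below[OF subgroup_self] that by blast
qed

lemma order_p2D:
  assumes "A \<in> order_p2"
  shows "subgroup A G" "card A = p ^ 2" "finite A" "comm_group (G\<lparr>carrier := A\<rparr>)" "I \<subseteq> A"
  using assms comm_group_order_p2 I_eq finite_subset[OF subgroup.subset finite]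
  by (auto simp: order_p2_def)

lemma subgroup_I: "subgroup I G"
proof -
  have "order_p2 \<noteq> {}"
    using exists_order_p2 by blast
  then show ?thesis
    unfolding I_eq using order_p2D(1) by (intro subgroups_Inter) auto
qed

lemma I_subset:
  assumes "subgroup H G" "p < card H"
  shows "I \<subseteq> H"
proof -
  obtain A where "A \<in> order_p2" "A \<subseteq> H"
    using exists_order_p2_below[OF assms] .
  then show ?thesis
    using order_p2D(5) by blast
qed

lemma I_central:
  assumes "z \<in> I" "x \<in> carrier G"
  shows "z \<otimes> x = x \<otimes> z"
proof -
  obtain M where M: "subgroup M G" "x \<in> M" "p < card M" "comm_group (G\<lparr>carrier := M\<rparr>)"
    using exists_abelian_subgroup[OF p_less_order assms(2)] .
  then have "z \<in> M"
    using I_subset assms(1) by blast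
  then show ?thesis
    using comm_monoid.m_comm[OF comm_group.axioms(1)[OF M(4)], of z x] M(2) by simp
qed

lemma comm_group_I: "comm_group (G\<lparr>carrier := I\<rparr>)"
  using I_central subgroup.subset[OF subgroup_I] by (intro comm_group_subgroupI[OF subgroup_I]) blast

text \<open>This is lambda: the quotient by the degree is the scalar by which \<open>z\<close> acts
  in a representation with the given character.\<close>

definition central_char :: "'a set \<times> ('a \<Rightarrow> complex) \<Rightarrow> 'a \<Rightarrow> complex" where
  "central_char x = (\<lambda>z\<in>I. snd x z / snd x \<one>)"

lemma \<Gamma>_D:
  assumes "(H, \<phi>) \<in> \<Gamma>"
  shows "subgroup H G" "p < card H" "\<phi> \<in> Irr (G\<lparr>carrier := H\<rparr>)" "I \<subseteq> H"
  using assms I_subset by (auto simp: Gamma1_def)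

lemma central_char_mult:
  assumes "(H, \<phi>) \<in> \<Gamma>" "z \<in> I" "h \<in> H"
  shows "\<phi> (z \<otimes> h) = central_char (H, \<phi>) z * \<phi> h" and "\<phi> \<one> \<noteq> 0"
proof -
  note D = \<Gamma>_D[OF assms(1)]
  have grp: "group (G\<lparr>carrier := H\<rparr>)"
    by (rule subgroup.subgroup_is_group[OF D(1) group_axioms])
  show one: "\<phi> \<one> \<noteq> 0"
    using Irr_one_neq_0[OF grp D(3)] by simp
  have "z \<in> H"
    using assms(2) D(4) by blast
  moreover have "z \<otimes> w = w \<otimes> z" if "w \<in> H" for w
    using I_central[OF assms(2)] subgroup.subset[OF D(1)] that by blast
  ultimately have "\<phi> (z \<otimes> h) * \<phi> \<one> = \<phi> z * \<phi> h"
    using Irr_mult_central[OF grp D(3), simplified, of z h] assms(3) by blast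
  then show "\<phi> (z \<otimes> h) = central_char (H, \<phi>) z * \<phi> h"
    using one assms(2) by (simp add: central_char_def field_simps)
qed

lemma central_char_in_linear_chars:
  assumes "x \<in> \<Gamma>"
  shows "central_char x \<in> linear_chars (G\<lparr>carrier := I\<rparr>)"
proof -
  obtain H \<phi> where x: "x = (H, \<phi>)" "(H, \<phi>) \<in> \<Gamma>"
    using assms by (cases x) auto
  note D = \<Gamma>_D[OF x(2)]
  have one: "\<one> \<in> I" "\<one> \<in> H"
    using subgroup.one_closed[OF subgroup_I] subgroup.one_closed[OF D(1)] .
  \<comment> \<open>Multiplicativity is the semi-invariance of \<open>\<phi>\<close> under
    \<open>z\<close>, evaluated at \<open>w\<close> in \<open>I\<close> and divided by the
    degree.\<close>
  have "central_char (H, \<phi>) (z \<otimes> w) = central_char (H, \<phi>) z * central_char (H, \<phi>) w"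
    if zw: "z \<in> I" "w \<in> I" for z w
  proof -
    have "w \<in> H"
      using D(4) zw(2) by blast
    then show ?thesis
      using central_char_mult(1)[OF x(2) zw(1), of w] subgroup.m_closed[OF subgroup_I zw] zw
      by (simp add: central_char_def)
  qed
  then show ?thesis
    using one central_char_mult(2)[OF x(2) one] by (auto simp: x(1) linear_chars_def central_char_def)
qed

lemma central_char_mono:
  assumes "(x, y) \<in> Gamma1_le p G"
  shows "central_char x = central_char y"
proof -
  obtain H \<phi> K \<psi> where x: "x = (H, \<phi>)" and y: "y = (K, \<psi>)"
    and mem: "(H, \<phi>) \<in> \<Gamma>" "(K, \<psi>) \<in> \<Gamma>" and HK: "H \<subseteq> K"
    and nz: "char_inner H \<phi> (restrict \<psi> H) \<noteq> 0"
    using assms by (auto simp: Gamma1_le_def)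
  interpret H: group "G\<lparr>carrier := H\<rparr>"
    by (rule subgroup.subgroup_is_group[OF \<Gamma>_D(1)[OF mem(1)] group_axioms])
  interpret I: comm_group "G\<lparr>carrier := I\<rparr>"
    by (rule comm_group_I)
  have finI: "finite I"
    using finite_subset[OF subgroup.subset[OF subgroup_I] finite] .
  have nz': "(\<Sum>h\<in>H. \<phi> h * cnj (\<psi> h)) \<noteq> 0"
    using nz by (auto simp: char_inner_def)
  have "central_char x z = central_char y z" if z: "z \<in> I" for z
  proof -
    have "central_char y z * cnj (central_char y z) = 1"
      using I.linear_char_norm(2)[OF _ central_char_in_linear_chars, of y z] finI mem(2) y z by simp
    moreover have "\<phi> (z \<otimes> h) = central_char x z * \<phi> h" "\<psi> (z \<otimes> h) = central_char y z * \<psi> h" if "h \<in> H" for h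
      using central_char_mult(1)[OF mem(1) z, of h] central_char_mult(1)[OF mem(2) z, of h] that HK x y by auto
    moreover have "z \<in> H"
      using z \<Gamma>_D(4)[OF mem(1)] by blast
    ultimately show ?thesis
      using H.sum_semi_invariant_eq[of z \<phi> "central_char x z" \<psi> "central_char y z"] nz' by simp
  qed
  then show ?thesis
    by (auto simp: central_char_def restrict_def fun_eq_iff)
qed

lemma linear_char_in_\<Gamma>:
  assumes "A \<in> order_p2" "\<mu> \<in> linear_chars (G\<lparr>carrier := A\<rparr>)"
  shows "(A, \<mu>) \<in> \<Gamma>"
  using order_p2D[OF assms(1)] assms(2) Irr_comm_group p_less_p2 by (auto simp: Gamma1_def)

lemma central_char_linear:
  assumes "A \<in> order_p2" "\<mu> \<in> linear_chars (G\<lparr>carrier := A\<rparr>)"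
  shows "central_char (A, \<mu>) = restrict \<mu> I"
  using assms(2) by (auto simp: central_char_def linear_chars_def)

section \<open>Joining pairs with the same central character\<close>

lemma linked_sym: "(x, y) \<in> linked \<Longrightarrow> (y, x) \<in> linked"
proof -
  have "sym linked"
    unfolding linked_def by (rule sym_rtrancl) (auto simp: sym_def)
  then show "(x, y) \<in> linked \<Longrightarrow> (y, x) \<in> linked"
    by (rule symD)
qed

lemma linked_trans: "(x, y) \<in> linked \<Longrightarrow> (y, z) \<in> linked \<Longrightarrow> (x, z) \<in> linked"
  unfolding linked_def by (rule rtrancl_trans)

lemma linked_le:
  assumes "(x, y) \<in> Gamma1_le p G"
  shows "(x, y) \<in> linked"
proof -
  have "x \<in> \<Gamma>" "y \<in> \<Gamma>"
    using assms by (auto simp: Gamma1_le_def)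
  then show ?thesis
    using assms unfolding linked_def by blast
qed

text \<open>The path has two steps and passes through a pair on the whole group, whose order exceeds
  \<open>p\<close>.\<close>

lemma linked_linear_chars:
  assumes A: "A \<in> order_p2" and B: "B \<in> order_p2"
    and \<mu>: "\<mu> \<in> linear_chars (G\<lparr>carrier := A\<rparr>)" and \<nu>: "\<nu> \<in> linear_chars (G\<lparr>carrier := B\<rparr>)"
    and agree: "\<And>x. x \<in> A \<inter> B \<Longrightarrow> \<mu> x = \<nu> x"
  shows "((A, \<mu>), (B, \<nu>)) \<in> linked"
proof -
  obtain \<psi> where \<psi>: "\<psi> \<in> Irr G" "char_inner A \<mu> (restrict \<psi> A) \<noteq> 0" "char_inner B \<nu> (restrict \<psi> B) \<noteq> 0"
    using Irr_above_two_linear_chars[OF finite order_p2D(1)[OF A] order_p2D(1)[OF B] \<mu> \<nu> agree] by blast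
  have "(carrier G, \<psi>) \<in> \<Gamma>"
    using \<psi>(1) order p_less_order subgroup_self by (simp add: Gamma1_def Coset.order_def)
  then have "((A, \<mu>), (carrier G, \<psi>)) \<in> Gamma1_le p G" "((B, \<nu>), (carrier G, \<psi>)) \<in> Gamma1_le p G"
    using linear_char_in_\<Gamma>[OF A \<mu>] linear_char_in_\<Gamma>[OF B \<nu>] \<psi>(2,3)
      subgroup.subset[OF order_p2D(1)[OF A]] subgroup.subset[OF order_p2D(1)[OF B]]
    by (auto simp: Gamma1_le_def)
  then show ?thesis
    using linked_le linked_sym linked_trans by blast
qed

text \<open>
  The induction step links \<open>\<mu>\<close> and \<open>\<nu>\<close> via a character \<open>\<kappa>\<close> of \<open>A\<close> that agrees with \<open>\<mu>\<close> on \<open>A \<inter> B\<close> and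
  with \<open>\<nu>\<close> on \<open>A \<inter> \<Inter>\<B>\<close>; the link from \<open>\<mu>\<close> to \<open>\<kappa>\<close> passes through a character of \<open>B\<close>.
\<close>

lemma linked_agree_on_inter:
  assumes A: "A \<in> order_p2" and "finite \<B>" "\<B> \<subseteq> order_p2"
    and "\<mu> \<in> linear_chars (G\<lparr>carrier := A\<rparr>)" "\<nu> \<in> linear_chars (G\<lparr>carrier := A\<rparr>)"
    and "\<And>x. x \<in> A \<inter> \<Inter>\<B> \<Longrightarrow> \<mu> x = \<nu> x"
  shows "((A, \<mu>), (A, \<nu>)) \<in> linked"
  using assms(2-)
proof (induction arbitrary: \<mu> \<nu> rule: finite_induct)
  case empty
  then have "\<mu> = \<nu>"
    by (intro extensionalityI[of _ A]) (auto simp: linear_chars_def)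
  then show ?case
    by (simp add: linked_def)
next
  case (insert B \<B>)
  note DA = order_p2D[OF A]
  have B: "B \<in> order_p2" and \<B>: "\<B> \<subseteq> order_p2"
    using insert.prems(1) by auto
  note DB = order_p2D[OF B]
  let ?X = "A \<inter> B" and ?Y = "A \<inter> \<Inter>\<B>"
  have X: "subgroup ?X G"
    by (rule subgroups_Inter_pair[OF DA(1) DB(1)])
  \<comment> \<open>The intersection of an empty family is the whole type; inserting
    \<open>A\<close> covers this case too.\<close>
  have "subgroup (\<Inter>(insert A \<B>)) G"
    using DA(1) \<B> order_p2D(1) by (intro subgroups_Inter) auto
  then have Y: "subgroup ?Y G"
    by simp
  \<comment> \<open>The joint extension exists because \<open>?X\<close> and \<open>?Y\<close> meet
    in the intersection of \<open>A\<close>, \<open>B\<close> and all of \<open>\<B>\<close>, where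
    \<open>\<mu>\<close> and \<open>\<nu>\<close> agree by hypothesis.\<close>
  obtain \<kappa> where \<kappa>: "\<kappa> \<in> linear_chars (G\<lparr>carrier := A\<rparr>)"
    "\<And>x. x \<in> ?X \<Longrightarrow> \<kappa> x = \<mu> x" "\<And>x. x \<in> ?Y \<Longrightarrow> \<kappa> x = \<nu> x"
  proof (rule extend_linear_chars[OF DA(3,1,4) X _ Y])
    show "restrict \<mu> ?X \<in> linear_chars (G\<lparr>carrier := ?X\<rparr>)" "restrict \<nu> ?Y \<in> linear_chars (G\<lparr>carrier := ?Y\<rparr>)"
      using linear_chars_restrict[OF X _ insert.prems(2)] linear_chars_restrict[OF Y _ insert.prems(3)] by auto
  qed (use insert.prems(4) in auto)
  obtain \<theta> where \<theta>: "\<theta> \<in> linear_chars (G\<lparr>carrier := B\<rparr>)" "\<And>x. x \<in> ?X \<Longrightarrow> \<theta> x = \<mu> x"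
  proof (rule extend_linear_chars[OF DB(3,1,4) X _ X])
    show "restrict \<mu> ?X \<in> linear_chars (G\<lparr>carrier := ?X\<rparr>)" "restrict \<mu> ?X \<in> linear_chars (G\<lparr>carrier := ?X\<rparr>)"
      using linear_chars_restrict[OF X _ insert.prems(2)] by auto
  qed auto
  \<comment> \<open>On \<open>?X\<close> the three characters \<open>\<mu>\<close>,
    \<open>\<kappa>\<close> and \<open>\<theta>\<close> coincide.\<close>
  have "((A, \<mu>), (B, \<theta>)) \<in> linked" "((A, \<kappa>), (B, \<theta>)) \<in> linked"
    using \<theta>(2) \<kappa>(2) by (auto intro!: linked_linear_chars[OF A B _ \<theta>(1)] insert.prems(2) \<kappa>(1))
  moreover have "((A, \<kappa>), (A, \<nu>)) \<in> linked"
    using insert.IH[OF \<B> \<kappa>(1) insert.prems(3)] \<kappa>(3) by blast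
  ultimately show ?case
    using linked_sym linked_trans by blast
qed

text \<open>Extending the restriction of \<open>\<nu>\<close> from \<open>A \<inter> B\<close> to a
  character \<open>\<kappa>\<close> of \<open>A\<close> reduces to two characters of the same
  subgroup. They agree on \<open>I\<close>, because \<open>I\<close> is contained in
  \<open>B\<close> as well.\<close>

lemma linked_linear_chars_agree_on_I:
  assumes A: "A \<in> order_p2" and B: "B \<in> order_p2"
    and \<mu>: "\<mu> \<in> linear_chars (G\<lparr>carrier := A\<rparr>)" and \<nu>: "\<nu> \<in> linear_chars (G\<lparr>carrier := B\<rparr>)"
    and agree: "\<And>x. x \<in> I \<Longrightarrow> \<mu> x = \<nu> x"
  shows "((A, \<mu>), (B, \<nu>)) \<in> linked"
proof -
  note DA = order_p2D[OF A] and DB = order_p2D[OF B]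
  let ?X = "A \<inter> B"
  have X: "subgroup ?X G"
    by (rule subgroups_Inter_pair[OF DA(1) DB(1)])
  obtain \<kappa> where \<kappa>: "\<kappa> \<in> linear_chars (G\<lparr>carrier := A\<rparr>)" "\<And>x. x \<in> ?X \<Longrightarrow> \<kappa> x = \<nu> x"
  proof (rule extend_linear_chars[OF DA(3,1,4) X _ X])
    show "restrict \<nu> ?X \<in> linear_chars (G\<lparr>carrier := ?X\<rparr>)" "restrict \<nu> ?X \<in> linear_chars (G\<lparr>carrier := ?X\<rparr>)"
      using linear_chars_restrict[OF X _ \<nu>] by auto
  qed auto
  have "order_p2 \<subseteq> Pow (carrier G)"
    using order_p2D(1) subgroup.subset by blast
  then have "finite order_p2"
    using finite finite_subset by blast
  moreover have "\<mu> x = \<kappa> x" if "x \<in> A \<inter> \<Inter>order_p2" for x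
    using that agree \<kappa>(2)[of x] B DA(5) by (auto simp: I_eq)
  ultimately have "((A, \<mu>), (A, \<kappa>)) \<in> linked"
    using linked_agree_on_inter[OF A _ subset_refl \<mu> \<kappa>(1)] by blast
  moreover have "((A, \<kappa>), (B, \<nu>)) \<in> linked"
    by (rule linked_linear_chars[OF A B \<kappa>(1) \<nu> \<kappa>(2)])
  ultimately show ?thesis
    by (rule linked_trans)
qed

lemma exists_linear_char_below:
  assumes x: "x \<in> \<Gamma>"
  obtains A \<mu> where "A \<in> order_p2" "\<mu> \<in> linear_chars (G\<lparr>carrier := A\<rparr>)" "((A, \<mu>), x) \<in> Gamma1_le p G"
proof -
  obtain H \<phi> where x_eq: "x = (H, \<phi>)"
    by (cases x)
  note D = \<Gamma>_D[OF x[unfolded x_eq]]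
  interpret H: finite_p_group "G\<lparr>carrier := H\<rparr>" p
    by (rule finite_p_subgroup[OF D(1)])
  obtain A where A: "A \<in> order_p2" "A \<subseteq> H"
    using exists_order_p2_below[OF D(1,2)] .
  note DA = order_p2D[OF A(1)]
  have sub: "subgroup A (G\<lparr>carrier := H\<rparr>)"
    by (rule subgroup_incl[OF DA(1) D(1) A(2)])
  obtain \<mu> where \<mu>: "\<mu> \<in> linear_chars (G\<lparr>carrier := A\<rparr>)" "char_inner A \<mu> (restrict \<phi> A) \<noteq> 0"
    using H.linear_char_below[OF H.finite sub _ D(3)] DA(4) by auto
  have "((A, \<mu>), x) \<in> Gamma1_le p G"
    using linear_char_in_\<Gamma>[OF A(1) \<mu>(1)] x A(2) \<mu>(2) by (simp add: Gamma1_le_def x_eq)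
  then show thesis
    using that A(1) \<mu>(1) by blast
qed

lemma linked_if_central_char_eq:
  assumes x: "x \<in> \<Gamma>" and y: "y \<in> \<Gamma>" and eq: "central_char x = central_char y"
  shows "(x, y) \<in> linked"
proof -
  obtain A \<mu> where A: "A \<in> order_p2" "\<mu> \<in> linear_chars (G\<lparr>carrier := A\<rparr>)" "((A, \<mu>), x) \<in> Gamma1_le p G"
    using exists_linear_char_below[OF x] .
  obtain B \<nu> where B: "B \<in> order_p2" "\<nu> \<in> linear_chars (G\<lparr>carrier := B\<rparr>)" "((B, \<nu>), y) \<in> Gamma1_le p G"
    using exists_linear_char_below[OF y] .
  have "restrict \<mu> I = restrict \<nu> I"
    using central_char_mono[OF A(3)] central_char_mono[OF B(3)] eq
      central_char_linear[OF A(1,2)] central_char_linear[OF B(1,2)] by simp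
  then have "\<mu> z = \<nu> z" if "z \<in> I" for z
    using that by (metis restrict_apply')
  then have "((A, \<mu>), (B, \<nu>)) \<in> linked"
    by (rule linked_linear_chars_agree_on_I[OF A(1) B(1) A(2) B(2)])
  then show ?thesis
    using linked_le[OF A(3)] linked_le[OF B(3)] linked_sym linked_trans by blast
qed

text \<open>Every value is attained already at order \<open>p ^ 2\<close>: a linear character of
  \<open>I\<close> extends to such a subgroup, and the central character of the extension is its
  restriction to \<open>I\<close>.\<close>

lemma central_char_surj: "central_char ` \<Gamma> = linear_chars (G\<lparr>carrier := I\<rparr>)"
proof (intro equalityI subsetI)
  fix \<mu> assume "\<mu> \<in> central_char ` \<Gamma>"
  then show "\<mu> \<in> linear_chars (G\<lparr>carrier := I\<rparr>)"
    using central_char_in_linear_chars by blast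
next
  fix \<mu> assume \<mu>: "\<mu> \<in> linear_chars (G\<lparr>carrier := I\<rparr>)"
  obtain A where A: "A \<in> order_p2"
    using exists_order_p2 .
  note DA = order_p2D[OF A]
  obtain \<kappa> where \<kappa>: "\<kappa> \<in> linear_chars (G\<lparr>carrier := A\<rparr>)" "\<And>x. x \<in> I \<Longrightarrow> \<kappa> x = \<mu> x"
    using extend_linear_chars[OF DA(3,1,4) subgroup_I DA(5) subgroup_I DA(5) \<mu> \<mu>] by blast
  have "\<mu> = restrict \<kappa> I"
    using \<mu> \<kappa>(2) by (intro extensionalityI[of _ I]) (auto simp: linear_chars_def)
  then have "\<mu> = central_char (A, \<kappa>)"
    using central_char_linear[OF A \<kappa>(1)] by simp
  then show "\<mu> \<in> central_char ` \<Gamma>"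
    using linear_char_in_\<Gamma>[OF A \<kappa>(1)] by blast
qed

lemma card_components: "card (poset_components \<Gamma> (Gamma1_le p G)) = card I"
proof -
  interpret I: comm_group "G\<lparr>carrier := I\<rparr>"
    by (rule comm_group_I)
  have "card (poset_components \<Gamma> (Gamma1_le p G)) = card (linear_chars (G\<lparr>carrier := I\<rparr>))"
    by (rule card_poset_components[OF central_char_surj central_char_mono
          linked_if_central_char_eq[unfolded linked_def]])
  also have "\<dots> = card I"
    using I.card_linear_chars finite_subset[OF subgroup.subset[OF subgroup_I] finite]
    by (simp add: Coset.order_def)
  finally show ?thesis .
qed

end

theorem theorem3:
  fixes G :: "('a, 'b) monoid_scheme" and p :: nat
  assumes "prime p"
    and "group G"
    and "finite (carrier G)"
    and "\<exists>k. Coset.order G = p ^ k"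
    and "Coset.order G \<ge> p ^ 2"
  shows "card (poset_components (Gamma1 p G) (Gamma1_le p G)) = card (inter_order_p2 p G) \<and>
    (\<not> poset_connected (Gamma1 p G) (Gamma1_le p G) \<longleftrightarrow> inter_order_p2 p G \<noteq> {\<one>\<^bsub>G\<^esub>})"
proof -
  interpret group G by fact
  interpret large_finite_p_group G p
    by unfold_locales (use assms in auto)
  have "poset_connected (Gamma1 p G) (Gamma1_le p G) \<longleftrightarrow> card I = 1"
    unfolding poset_connected_def card_components[symmetric] by (auto simp: card_1_singleton_iff)
  also have "\<dots> \<longleftrightarrow> I = {\<one>\<^bsub>G\<^esub>}"
    using subgroup.one_closed[OF subgroup_I] by (auto simp: card_1_singleton_iff)
  finally show ?thesis
    using card_components by simp
qed

end
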